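(* Let $G$ be a graph with $n$ vertices and chromatic polynomial $P_G$, and suppose $G$ is chromatically equivalent to (i.e. has the same chromatic polynomial as) a graph which contains a vertex of degree $n-1$. Define $h'_0,\dots,h'_{n-2}$ by $$h'_0+h'_1t+\cdots+h'_{n-2}t^{n-2}=(1-t)^{n-1}\sum_{j=0}^\infty\frac{(j+1)^n-P_G(j+1)}{j+1}\,t^j.$$ Then (1) $h'_0\le h'_1\le\cdots\le h'_{\lfloor (n-2)/2\rfloor}$; (2) for $i\le (n-2)/2$, $h'_i\le h'_{n-2-i}$; (3) $(h'_0,\,h'_1-h'_0,\,\dots,\,h'_{\lceil (n-2)/2\rceil}-h'_{\lceil (n-2)/2\rceil-1})$ is an M-vector.
   Context: A sequence of nonnegative integers $(m_0,\dots,m_d)$ is an M-vector if it is the Hilbert function of a homogeneous quotient of a polynomial ring (standard graded), equivalently the degree sequence of an order ideal of monomials; by Macaulay's theorem this holds iff $m_0=1$ and $m_{i+1}\le m_i^{\langle i\rangle}$ for $1\le i\le d-1$, where writing $m_i=\binom{a_i}{i}+\cdots+\binom{a_j}{j}$ with $a_i>\cdots>a_j\ge j\ge1$, one sets $m_i^{\langle i\rangle}=\binom{a_i+1}{i+1}+\cdots+\binom{a_j+1}{j+1}$. *)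

theory Defs
  imports
    "Graph_Theory.Pair_Digraph"
    "HOL-Library.FuncSet"
    "HOL-Library.Poly_Mapping"
    "HOL-Computational_Algebra.Polynomial"
    "HOL-Computational_Algebra.Formal_Power_Series"
begin

section \<open>Chromatic polynomials\<close>

text \<open>
  A finite simple graph is a \<^const>\<open>pair_graph\<close>: each undirected edge is represented by its
  two orientations, so the degree of a vertex is its \<^const>\<open>out_degree\<close>.
\<close>

definition proper_colourings :: "'a pair_pre_digraph \<Rightarrow> nat \<Rightarrow> ('a \<Rightarrow> nat) set" where
  "proper_colourings G k =
     {c \<in> pverts G \<rightarrow>\<^sub>E {..<k}. \<forall>(u, v) \<in> parcs G. c u \<noteq> c v}"

definition chromatic_polynomial :: "'a pair_pre_digraph \<Rightarrow> int poly" where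
  "chromatic_polynomial G = (THE p. \<forall>k. poly p (int k) = int (card (proper_colourings G k)))"

lemma colourings_polynomial_exists:
  assumes "finite V" "finite E" "E \<subseteq> V \<times> V"
  shows "\<exists>p :: int poly. \<forall>k. poly p (int k) =
           int (card {c \<in> V \<rightarrow>\<^sub>E {..<k}. \<forall>(u, v) \<in> E. c u \<noteq> c v})"
  using assms
proof (induction "card E" arbitrary: V E rule: less_induct)
  case less
  show ?case
  proof (cases "E = {}")
    case True
    have "poly (monom 1 (card V)) (int k) = int (card (V \<rightarrow>\<^sub>E {..<k}))" for k
      using less.prems by (simp add: card_PiE poly_monom)
    then show ?thesis using True by auto
  next
    case False
    then obtain u v where uv: "(u, v) \<in> E" by auto
    define F where "F = E - {(u, v)}"
    have F: "E = insert (u, v) F" "(u, v) \<notin> F" "finite F" "F \<subseteq> V \<times> V"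
      using uv less.prems by (auto simp: F_def)
    have cardF: "card F < card E"
      unfolding F_def using less.prems(2) uv by (rule card_Diff1_less)
    have uV: "u \<in> V" "v \<in> V" using uv less.prems by auto
    show ?thesis
    proof (cases "u = v")
      case True
      have "{c \<in> V \<rightarrow>\<^sub>E {..<k}. \<forall>(u, v) \<in> E. c u \<noteq> c v} = {}" for k :: nat
        using uv True by auto
      then show ?thesis by (intro exI[of _ 0]) (simp only: card.empty of_nat_0 poly_0 simp_thms)
    next
      case False
      define r where "r = (\<lambda>x. if x = v then u else x)"
      define W where "W = V - {v}"
      define F' where "F' = map_prod r r ` F"
      define A where "A k = {c \<in> V \<rightarrow>\<^sub>E {..<k::nat}. \<forall>(x, y) \<in> F. c x \<noteq> c y}" for k
      define B where "B k = {c \<in> A k. c u = c v}" for k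
      define C where "C k = {c \<in> W \<rightarrow>\<^sub>E {..<k::nat}. \<forall>(x, y) \<in> F'. c x \<noteq> c y}" for k
      have rW: "r x \<in> W" if "x \<in> V" for x
        using that uV False by (auto simp: r_def W_def)
      have F': "finite F'" "F' \<subseteq> W \<times> W" "card F' < card E"
        using F cardF rW card_image_le[of F "map_prod r r"] by (auto simp: F'_def)
      obtain p :: "int poly" where p: "poly p (int k) = int (card (A k))" for k
        using less.hyps[OF cardF less.prems(1) F(3,4)] unfolding A_def by auto
      obtain q :: "int poly" where q: "poly q (int k) = int (card (C k))" for k
        using less.hyps[OF F'(3) _ F'(1,2)] less.prems(1) unfolding C_def W_def by auto
      have BC: "card (B k) = card (C k)" for k
      proof (rule bij_betw_same_card[of "\<lambda>c. restrict c W"],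
             rule bij_betw_byWitness[of _ "\<lambda>c. restrict (\<lambda>x. c (r x)) V"])
        show "\<forall>c\<in>B k. restrict (\<lambda>x. restrict c W (r x)) V = c"
        proof
          fix c assume c: "c \<in> B k"
          show "restrict (\<lambda>x. restrict c W (r x)) V = c"
          proof
            fix x
            show "restrict (\<lambda>x. restrict c W (r x)) V x = c x"
              using c rW[of x] by (cases "x \<in> V")
                (auto simp: B_def A_def r_def PiE_def extensional_def split: if_splits)
          qed
        qed
        show "\<forall>c\<in>C k. restrict (restrict (\<lambda>x. c (r x)) V) W = c"
        proof
          fix c assume c: "c \<in> C k"
          show "restrict (restrict (\<lambda>x. c (r x)) V) W = c"
          proof
            fix x
            show "restrict (restrict (\<lambda>x. c (r x)) V) W x = c x"
              using c by (cases "x \<in> W")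
                (auto simp: C_def W_def r_def PiE_def extensional_def)
          qed
        qed
        show "(\<lambda>c. restrict c W) ` B k \<subseteq> C k"
        proof (clarify)
          fix c assume c: "c \<in> B k"
          have cr: "c (r x) = c x" for x using c by (auto simp: B_def r_def)
          have "restrict c W (r x) \<noteq> restrict c W (r y)" if "(x, y) \<in> F" for x y
            using that c rW[of x] rW[of y] F(4) cr by (auto simp: B_def A_def)
          moreover have "restrict c W \<in> W \<rightarrow>\<^sub>E {..<k}"
            using c by (auto simp: B_def A_def W_def)
          ultimately show "restrict c W \<in> C k" unfolding C_def F'_def by (auto simp del: restrict_apply)
        qed
        show "(\<lambda>c. restrict (\<lambda>x. c (r x)) V) ` C k \<subseteq> B k"
        proof (clarify)
          fix c assume c: "c \<in> C k"
          have "c (r x) \<noteq> c (r y)" if "(x, y) \<in> F" for x y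
          proof -
            have "(r x, r y) \<in> F'" unfolding F'_def using that by (rule map_prod_imageI)
            then show ?thesis using c by (auto simp: C_def)
          qed
          then have "restrict (\<lambda>x. c (r x)) V x \<noteq> restrict (\<lambda>x. c (r x)) V y"
            if "(x, y) \<in> F" for x y
            using that F(4) by auto
          moreover have "restrict (\<lambda>x. c (r x)) V \<in> V \<rightarrow>\<^sub>E {..<k}"
            using c rW by (auto simp: C_def)
          moreover have "restrict (\<lambda>x. c (r x)) V u = restrict (\<lambda>x. c (r x)) V v"
            using uV by (simp add: r_def)
          ultimately show "restrict (\<lambda>x. c (r x)) V \<in> B k"
            unfolding B_def A_def by (auto simp del: restrict_apply)
        qed
      qed
      have finA: "finite (A k)" for k
        unfolding A_def using less.prems(1) by (auto intro!: finite_PiE)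
      have "{c \<in> V \<rightarrow>\<^sub>E {..<k}. \<forall>(u, v) \<in> E. c u \<noteq> c v} = A k - B k" for k
        unfolding A_def B_def F(1) by auto
      then have "int (card {c \<in> V \<rightarrow>\<^sub>E {..<k}. \<forall>(u, v) \<in> E. c u \<noteq> c v})
                 = int (card (A k)) - int (card (B k))" for k
        using card_Diff_subset[of "B k" "A k"] card_mono[OF finA, of "B k" k]
          finite_subset[OF _ finA, of "B k" k] by (auto simp: B_def)
      then have "poly (p - q) (int k) =
          int (card {c \<in> V \<rightarrow>\<^sub>E {..<k}. \<forall>(u, v) \<in> E. c u \<noteq> c v})" for k
        using p q BC by simp
      then show ?thesis by blast
    qed
  qed
qed

lemma poly_int_eqI:
  fixes p q :: "int poly"
  assumes "\<And>k. poly p (int k) = poly q (int k)"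
  shows "p = q"
proof (rule ccontr)
  assume "p \<noteq> q"
  then have "finite {x. poly (p - q) x = 0}" by (intro poly_roots_finite) simp
  moreover have "range int \<subseteq> {x. poly (p - q) x = 0}" using assms by auto
  ultimately have "finite (range int)" by (rule rev_finite_subset)
  then show False by (simp add: finite_image_iff)
qed

lemma poly_chromatic_polynomial:
  assumes "pair_graph G"
  shows "poly (chromatic_polynomial G) (int k) = int (card (proper_colourings G k))"
proof -
  interpret pair_graph G by fact
  have "\<exists>p :: int poly. \<forall>k. poly p (int k) = int (card (proper_colourings G k))"
    unfolding proper_colourings_def
    using arc_fst_in_verts arc_snd_in_verts
    by (intro colourings_polynomial_exists[OF pair_finite_verts pair_finite_arcs]) fastforce
  then have "\<exists>!p :: int poly. \<forall>k. poly p (int k) = int (card (proper_colourings G k))"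
    by (auto intro: poly_int_eqI)
  from theI'[OF this] show ?thesis by (simp add: chromatic_polynomial_def)
qed


section \<open>M-vectors\<close>

text \<open>
  The polynomial ring in the variables \<open>x\<^sub>0, \<dots>, x\<^bsub>r-1\<^esub>\<close>: monomials are exponent vectors, and
  a polynomial maps monomials to coefficients.  The grading is the standard one.
\<close>

type_synonym 'k mpoly = "(nat \<Rightarrow>\<^sub>0 nat) \<Rightarrow>\<^sub>0 'k"

definition mpoly_ring :: "nat \<Rightarrow> 'k::field mpoly set" where
  "mpoly_ring r = {p. \<forall>m \<in> Poly_Mapping.keys p. Poly_Mapping.keys m \<subseteq> {..<r}}"

definition mon_degree :: "(nat \<Rightarrow>\<^sub>0 nat) \<Rightarrow> nat" where
  "mon_degree m = (\<Sum>x \<in> Poly_Mapping.keys m. Poly_Mapping.lookup m x)"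

definition graded_piece :: "nat \<Rightarrow> nat \<Rightarrow> 'k::field mpoly set" where
  "graded_piece r i = {p \<in> mpoly_ring r. \<forall>m \<in> Poly_Mapping.keys p. mon_degree m = i}"

definition hom_component :: "nat \<Rightarrow> 'k::field mpoly \<Rightarrow> 'k mpoly" where
  "hom_component i p = (\<Sum>m \<in> {m \<in> Poly_Mapping.keys p. mon_degree m = i}. Poly_Mapping.single m (Poly_Mapping.lookup p m))"

definition homogeneous_ideal :: "nat \<Rightarrow> 'k::field mpoly set \<Rightarrow> bool" where
  "homogeneous_ideal r I \<longleftrightarrow>
     I \<subseteq> mpoly_ring r \<and> 0 \<in> I \<and>
     (\<forall>f \<in> I. \<forall>g \<in> I. f + g \<in> I) \<and>
     (\<forall>f \<in> mpoly_ring r. \<forall>g \<in> I. f * g \<in> I) \<and>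
     (\<forall>f \<in> I. \<forall>i. hom_component i f \<in> I)"

text \<open>
  The degree \<open>i\<close> part of the quotient by \<open>I\<close> has dimension \<open>d\<close>: there are \<open>d\<close> forms of degree
  \<open>i\<close> whose residue classes modulo \<open>I\<close> are linearly independent and span.  The scalar \<open>a\<close> acts
  as multiplication by the constant polynomial \<open>single 0 a\<close>.
\<close>

definition quotient_piece_dim :: "nat \<Rightarrow> 'k::field mpoly set \<Rightarrow> nat \<Rightarrow> nat \<Rightarrow> bool" where
  "quotient_piece_dim r I i d \<longleftrightarrow>
     (\<exists>B. finite B \<and> card B = d \<and> B \<subseteq> graded_piece r i \<and>
       (\<forall>a. (\<Sum>b \<in> B. Poly_Mapping.single 0 (a b) * b) \<in> I \<longrightarrow> (\<forall>b \<in> B. a b = 0)) \<and>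
       (\<forall>f \<in> graded_piece r i. \<exists>a. f - (\<Sum>b \<in> B. Poly_Mapping.single 0 (a b) * b) \<in> I))"

definition is_hilbert_function :: "nat \<Rightarrow> 'k::field mpoly set \<Rightarrow> (nat \<Rightarrow> nat) \<Rightarrow> bool" where
  "is_hilbert_function r I H \<longleftrightarrow> (\<forall>i. quotient_piece_dim r I i (H i))"

text \<open>
  The finite sequence \<open>m 0, \<dots>, m d\<close>, continued by zeros, is the Hilbert function of a nonzero
  homogeneous quotient of a polynomial ring over \<open>'k\<close>.  The quotient has to be nonzero, as
  M-vectors start with 1.  Entries are rational numbers because they will be differences of
  coefficients of a rational power series.
\<close>

definition M_vector :: "'k::field itself \<Rightarrow> nat \<Rightarrow> (nat \<Rightarrow> rat) \<Rightarrow> bool" where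
  "M_vector _ d m \<longleftrightarrow>
     (\<exists>r (I :: 'k mpoly set) H.
        homogeneous_ideal r I \<and> 1 \<notin> I \<and> is_hilbert_function r I H \<and>
        (\<forall>i \<le> d. m i = of_nat (H i)) \<and> (\<forall>i > d. H i = 0))"

end

theory Submission
  imports Defs
begin

text \<open>
  Let \<open>m = n - 1\<close>. The graph with a vertex of degree \<open>n - 1\<close> is a cone over a graph \<open>K\<close> on \<open>m\<close> vertices,
  so \<open>h'(t)\<close> is \<open>(1 - t)^m\<close> times the generating function of \<open>(j + 1)^m - P\<^sub>K(j)\<close>. The part
  \<open>(j + 1)^m - j^m\<close> contributes the Eulerian polynomial \<open>A\<^sub>m(t)\<close>. The part \<open>j^m - P\<^sub>K(j)\<close> counts improper
  colourings; sorting them by their first monochromatic edge gives a sum \<open>C(t)\<close> of numerators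
  \<open>(1 - t)^m \<Sum>\<^sub>j P\<^sub>L(j) t^j\<close> of graphs \<open>L\<close> on \<open>m - 1\<close> vertices.

  Splitting proper colourings by the induced acyclic orientation, and the strict maps of an
  acyclic digraph by the value at a sink, shows inductively that the numerator of a graph on
  \<open>N > 0\<close> vertices is a nonnegative combination of polynomials \<open>t^p (1 + t)^q\<close> with \<open>2 p + q \<ge> N + 1\<close>.
  Such a polynomial is symmetric and unimodal with centre \<open>p + q / 2\<close>, so the coefficients of \<open>C\<close>
  satisfy (1) and (2), as do those of \<open>A\<^sub>m\<close>.

  Moreover \<open>(1 - t) h'(t)\<close> is \<open>A\<^sub>m(t)\<close> minus the numerator of \<open>K\<close>, so for \<open>i \<le> m / 2\<close> its coefficients
  lie between \<open>A(m, i) - A(m, i - 1)\<close> and \<open>A(m, i)\<close>. Eulerian numbers grow so slowly in \<open>i\<close> that any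
  integer sequence between these bounds satisfies Macaulay's condition, with room to spare: for
  every \<open>i < m / 2\<close> some number \<open>v\<close> of variables has at most \<open>A(m, i) - A(m, i - 1)\<close> monomials of
  degree \<open>i\<close> and at least \<open>A(m, i + 1)\<close> monomials of degree \<open>i + 1\<close>.
\<close>

section \<open>Eulerian numbers\<close>

text \<open>The number of permutations of \<open>m\<close> letters with \<open>i\<close> descents;
  the polynomial starts with constant term 1 and has degree \<open>m - 1\<close> for
  \<open>m > 0\<close>.\<close>

primrec eulerian :: "nat \<Rightarrow> nat \<Rightarrow> nat" where
  "eulerian 0 i = (if i = 0 then 1 else 0)"
| "eulerian (Suc m) i =
     Suc i * eulerian m i + (if i = 0 then 0 else (Suc m - i) * eulerian m (i - 1))"

declare eulerian.simps(2) [simp del]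

lemma eulerian_0_right [simp]: "eulerian m 0 = 1"
  by (induction m) (auto simp: eulerian.simps(2))

lemma of_nat_eulerian_Suc_Suc:
  assumes "i \<le> m"
  shows "(of_nat (eulerian (Suc m) (Suc i)) :: 'a :: comm_ring_1) =
    (of_nat i + 2) * of_nat (eulerian m (Suc i)) + (of_nat m - of_nat i) * of_nat (eulerian m i)"
  using assms by (simp add: eulerian.simps(2) of_nat_diff distrib_right)

lemma eulerian_eq_0: "m \<le> i \<Longrightarrow> 0 < i \<Longrightarrow> eulerian m i = 0"
proof (induction m arbitrary: i)
  case (Suc m)
  then show ?case by (cases "i = Suc m") (auto simp: eulerian.simps(2))
qed auto

lemma eulerian_symmetric: "i + j + 1 = m \<Longrightarrow> eulerian m i = eulerian m j"
proof (induction m arbitrary: i j)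
  case (Suc m)
  then have m: "m = i + j" by simp
  consider "i = 0" "j = 0" | "i = 0" "j > 0" | "i > 0" "j = 0" | "i > 0" "j > 0" by auto
  then show ?case
  proof cases
    case 4
    have "eulerian m i = eulerian m (j - 1)" "eulerian m (i - 1) = eulerian m j"
      using 4 m by (intro Suc.IH; simp)+
    then show ?thesis using 4 m by (simp add: eulerian.simps(2))
  next
    case 2
    then have "eulerian m 0 = eulerian m (j - 1)" using m by (intro Suc.IH) auto
    then show ?thesis using 2 m by (simp add: eulerian.simps(2) eulerian_eq_0)
  next
    case 3
    then have "eulerian m (i - 1) = eulerian m 0" using m by (intro Suc.IH) auto
    then show ?thesis using 3 m by (simp add: eulerian.simps(2) eulerian_eq_0)
  qed auto
qed simp

text \<open>Up to the middle, Eulerian numbers grow at least as fast as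
  \<open>(m - 1) choose i\<close>. After the recurrence is applied to both sides, the terms in
  \<open>eulerian m i\<close> cancel. What is left compares the indices \<open>i - 1\<close> and
  \<open>i + 1\<close>, by two uses of the induction hypothesis or, next to the middle, by
  symmetry.\<close>

lemma eulerian_pred_le:
  "2 * Suc i \<le> m \<Longrightarrow>
    (real m - real (Suc i)) * real (eulerian m i) \<le> real (Suc i) * real (eulerian m (Suc i))"
proof (induction m arbitrary: i)
  case (Suc m)
  show ?case
  proof (cases i)
    case 0
    then show ?thesis by (simp add: eulerian.simps(2))
  next
    case (Suc l)
    define a b c where "a = real (eulerian m (Suc i))" and "b = real (eulerian m i)"
      and "c = real (eulerian m l)"
    have step1: "real (eulerian (Suc m) (Suc i)) = (real i + 2) * a + (real m - real i) * b"
      using Suc.prems by (simp add: a_def b_def of_nat_eulerian_Suc_Suc)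
    have step0: "real (eulerian (Suc m) i) = (real i + 1) * b + (real m - real l) * c"
      using Suc.prems \<open>i = Suc l\<close> by (simp add: c_def b_def of_nat_eulerian_Suc_Suc)
    have key: "(real m - real i) * (real m - real l) * c \<le> (real i + 1) * (real i + 2) * a"
    proof (cases "2 * Suc i \<le> m")
      case True
      have ab: "(real m - real i - 1) * b \<le> (real i + 1) * a"
        using Suc.IH[OF True] by (simp add: a_def b_def algebra_simps)
      have bc: "(real m - real i) * c \<le> real i * b"
        using Suc.IH[of l] True \<open>i = Suc l\<close> by (simp add: c_def b_def algebra_simps)
      have pos: "real i > 0" "real m - real i - 1 \<ge> 0" "c \<ge> 0"
        using True \<open>i = Suc l\<close> by (auto simp: c_def)
      have "real i * ((real m - real i) * (real m - real l) * c)
          \<le> (real i + 2) * (real m - real i - 1) * ((real m - real i) * c)"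
      proof -
        \<comment> \<open>The right side exceeds the left by
          \<open>2 * (m - 2 * i - 1)\<close>.\<close>
        have "real i * (real m - real l) \<le> (real i + 2) * (real m - real i - 1)"
          using True \<open>i = Suc l\<close> by (simp add: algebra_simps)
        moreover have "(real m - real i) * c \<ge> 0" using pos by (intro mult_nonneg_nonneg) auto
        ultimately have "real i * (real m - real l) * ((real m - real i) * c)
          \<le> (real i + 2) * (real m - real i - 1) * ((real m - real i) * c)"
          by (rule mult_right_mono)
        then show ?thesis by (simp add: mult_ac)
      qed
      also have "\<dots> \<le> (real i + 2) * (real m - real i - 1) * (real i * b)"
        using bc pos by (intro mult_left_mono) auto
      also have "\<dots> = real i * (real i + 2) * ((real m - real i - 1) * b)"
        by (simp add: mult_ac)
      also have "\<dots> \<le> real i * (real i + 2) * ((real i + 1) * a)"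
        using ab pos by (intro mult_left_mono) auto
      finally have "real i * ((real m - real i) * (real m - real l) * c)
          \<le> real i * ((real i + 1) * (real i + 2) * a)" by (simp add: mult_ac)
      then show ?thesis using pos(1) by (rule mult_left_le_imp_le)
    next
      case False
      then have m: "m = Suc (2 * i)" using Suc.prems by simp
      have "eulerian m (Suc i) = eulerian m l"
        using m \<open>i = Suc l\<close> by (intro eulerian_symmetric) simp
      then show ?thesis using m \<open>i = Suc l\<close> by (simp add: a_def c_def mult_ac add_ac)
    qed
    show ?thesis unfolding step1 step0 using key by (simp add: algebra_simps)
  qed
qed simp

lemma eulerian_mono:
  assumes "2 * Suc i \<le> m"
  shows "eulerian m i \<le> eulerian m (Suc i)"
proof -
  have "real (Suc i) * real (eulerian m i) \<le> (real m - real (Suc i)) * real (eulerian m i)"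
    using assms by (intro mult_right_mono) auto
  also have "\<dots> \<le> real (Suc i) * real (eulerian m (Suc i))"
    by (rule eulerian_pred_le[OF assms])
  finally show ?thesis by (simp del: of_nat_Suc)
qed

section \<open>Differences of Eulerian numbers and upper bounds for their growth\<close>

definition eulerian_diff :: "nat \<Rightarrow> nat \<Rightarrow> real" where
  "eulerian_diff m i = real (eulerian m i) - (if i = 0 then 0 else real (eulerian m (i - 1)))"

lemma eulerian_diff_nonneg: "2 * i \<le> m \<Longrightarrow> 0 \<le> eulerian_diff m i"
  using eulerian_mono[of "i - 1" m] by (cases i) (auto simp: eulerian_diff_def)

lemma eulerian_diff_Suc:
  assumes "i \<le> m"
  shows "eulerian_diff (Suc m) (Suc i) =
    (real i + 2) * eulerian_diff m (Suc i) + (real m + 1 - real i) * eulerian_diff m i"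
  using assms
  by (cases i) (simp_all add: eulerian_diff_def of_nat_eulerian_Suc_Suc algebra_simps)

text \<open>Induction on the distance \<open>k\<close> from \<open>m = 2 * i + 2\<close>, where
  symmetry makes both numbers equal. On the right only
  \<open>(i + 1) * eulerian m i <= eulerian (m + 1) i\<close> is used; on the left Bernoulli's
  inequality absorbs the second term of the recurrence.\<close>

lemma eulerian_Suc_le:
  "real (eulerian (2 * i + 2 + k) (Suc i)) \<le>
    (real k + 1) * ((real i + 2) / (real i + 1)) ^ k * real (eulerian (2 * i + 2 + k) i)"
proof (induction k)
  case 0
  have "eulerian (2 * i + 2) (Suc i) = eulerian (2 * i + 2) i"
    by (rule eulerian_symmetric) simp
  then show ?case by simp
next
  case (Suc k)
  define m y where "m = 2 * i + 2 + k" and "y = (real i + 2) / (real i + 1)"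
  define a b where "a = real (eulerian m (Suc i))" and "b = real (eulerian m i)"
  have ab: "a \<le> (real k + 1) * y ^ k * b"
    using Suc.IH by (simp add: a_def b_def m_def y_def)
  have y: "real i + 2 = y * (real i + 1)" "y \<ge> 1" "y = 1 + 1 / (real i + 1)"
    by (auto simp: y_def field_simps)
  have "1 + real k * (1 / (real i + 1)) \<le> y ^ k"
    unfolding y(3) by (rule Bernoulli_inequality) (simp add: field_simps)
  then have "(real i + 1) * (1 + real k * (1 / (real i + 1))) \<le> (real i + 1) * y ^ k"
    by (intro mult_left_mono) auto
  moreover have "(real i + 1) * (1 + real k * (1 / (real i + 1))) = real i + 1 + real k"
    by (simp add: distrib_left)
  ultimately have "real i + 1 + real k \<le> (real i + 1) * y ^ k" by (simp only:)
  moreover have "1 \<le> y ^ k" using y by simp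
  ultimately have bern: "real i + 2 + real k \<le> (real i + 2) * y ^ k" by (simp add: algebra_simps)
  have "real (eulerian (Suc m) (Suc i)) = (real i + 2) * a + (real i + 2 + real k) * b"
    by (simp add: a_def b_def m_def of_nat_eulerian_Suc_Suc)
  also have "\<dots> \<le> (real i + 2) * ((real k + 1) * y ^ k * b) + (real i + 2) * y ^ k * b"
    using ab bern by (intro add_mono mult_left_mono mult_right_mono) (auto simp: b_def)
  also have "\<dots> = (real k + 2) * y ^ k * ((real i + 2) * b)" by (simp add: algebra_simps)
  also have "\<dots> = (real k + 2) * y ^ Suc k * ((real i + 1) * b)"
    by (simp add: y(1) algebra_simps)
  also have "\<dots> \<le> (real k + 2) * y ^ Suc k * real (eulerian (Suc m) i)"
    using y(2) by (intro mult_left_mono) (auto simp: b_def eulerian.simps(2) algebra_simps)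
  finally show ?case by (simp add: m_def y_def add_ac)
qed

text \<open>For \<open>m = 2 * i + 2 + k\<close>, \<open>eulerian_pred_le\<close> at
  \<open>i - 1\<close> reads \<open>(i + 2 + k) * eulerian m (i - 1) <= i * eulerian m i\<close>,
  which bounds the subtracted term of the difference.\<close>

lemma eulerian_le_diff:
  assumes "0 < i"
  shows "(real k + 2) * real (eulerian (2 * i + 2 + k) i)
    \<le> (real i + 2 + real k) * eulerian_diff (2 * i + 2 + k) i"
  using eulerian_pred_le[of "i - 1" "2 * i + 2 + k"] assms
  by (cases i) (simp_all add: eulerian_diff_def algebra_simps)

text \<open>This is the growth that Macaulay's condition has to allow. The ratios
  \<open>(i + 2) / (i + 1)\<close> from \<open>eulerian_Suc_le\<close> and
  \<open>(i + 3) / (i + 2)\<close> from Bernoulli's inequality telescope to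
  \<open>(i + 3) / (i + 1)\<close>.\<close>

lemma eulerian_Suc_le_diff:
  assumes "0 < i"
  shows "real (eulerian (2 * i + 2 + k) (Suc i))
    \<le> (real i + 2) * ((real i + 3) / (real i + 1)) ^ k * eulerian_diff (2 * i + 2 + k) i"
proof -
  define m y z where "m = 2 * i + 2 + k" and "y = (real i + 2) / (real i + 1)"
    and "z = (real i + 3) / (real i + 2)"
  have L: "eulerian_diff m i \<ge> 0" by (rule eulerian_diff_nonneg) (simp add: m_def)
  have "y > 0" by (simp add: y_def)
  have yz: "(real i + 3) / (real i + 1) = z * y"
    by (simp add: y_def z_def)
  have z: "z = 1 + 1 / (real i + 2)" by (simp add: z_def field_simps)
  have "1 + real k * (1 / (real i + 2)) \<le> z ^ k"
    unfolding z by (rule Bernoulli_inequality) (simp add: field_simps)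
  then have "(real i + 2) * (1 + real k * (1 / (real i + 2))) \<le> (real i + 2) * z ^ k"
    by (intro mult_left_mono) auto
  moreover have "(real i + 2) * (1 + real k * (1 / (real i + 2))) = real i + 2 + real k"
    by (simp add: distrib_left)
  ultimately have bern: "real i + 2 + real k \<le> (real i + 2) * z ^ k" by (simp only:)
  have "(real k + 1) * real (eulerian m i) \<le> (real k + 2) * real (eulerian m i)"
    by (intro mult_right_mono) auto
  also have "\<dots> \<le> (real i + 2 + real k) * eulerian_diff m i"
    using eulerian_le_diff[OF assms, of k] by (simp add: m_def)
  also have "\<dots> \<le> (real i + 2) * z ^ k * eulerian_diff m i"
    using bern L by (rule mult_right_mono)
  finally have le: "(real k + 1) * real (eulerian m i) \<le> (real i + 2) * z ^ k * eulerian_diff m i" .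
  have "real (eulerian m (Suc i)) \<le> y ^ k * ((real k + 1) * real (eulerian m i))"
    using eulerian_Suc_le[of i k] by (simp add: m_def y_def mult_ac)
  also have "\<dots> \<le> y ^ k * ((real i + 2) * z ^ k * eulerian_diff m i)"
    using le \<open>y > 0\<close> by (intro mult_left_mono) auto
  finally show ?thesis unfolding yz power_mult_distrib m_def by (simp add: mult_ac)
qed

section \<open>Comparison with numbers of monomials\<close>

lemma pochhammer_mono:
  fixes x y :: real
  assumes "0 \<le> x" "x \<le> y"
  shows "pochhammer x n \<le> pochhammer y n"
  unfolding pochhammer_prod using assms by (intro prod_mono) auto

lemma pochhammer_mult_le:
  fixes c x :: real
  assumes "1 \<le> c" "0 \<le> x"
  shows "pochhammer (c * x) n \<le> c ^ n * pochhammer x n"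
proof -
  have "pochhammer (c * x) n \<le> (\<Prod>i = 0..<n. c * (x + real i))"
    unfolding pochhammer_prod
  proof (intro prod_mono conjI)
    fix i
    have "1 * real i \<le> c * real i" using assms by (intro mult_right_mono) auto
    then show "c * x + real i \<le> c * (x + real i)" by (simp add: algebra_simps)
    show "0 \<le> c * x + real i" using assms by simp
  qed
  then show ?thesis by (simp add: prod.distrib pochhammer_prod)
qed

text \<open>The left side is at most the square of \<open>exp 1\<close>, hence at most 9; the cases
  \<open>i < 8\<close> are computed. So scaling the argument of \<open>pochhammer _ i\<close> by
  \<open>(i + 3) / (i + 1)\<close> costs at most a factor \<open>i + 1\<close>.\<close>

lemma power_ratio_le: "((real i + 3) / (real i + 1)) ^ i \<le> real i + 1"
proof (cases "i \<ge> 8")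
  case True
  have x: "(real i + 3) / (real i + 1) = 1 + 2 / (real i + 1)" by (simp add: field_simps)
  have "((real i + 3) / (real i + 1)) ^ i \<le> exp (2 / (real i + 1)) ^ i"
    unfolding x by (intro power_mono exp_ge_add_one_self) simp_all
  also have "\<dots> = exp (real i * (2 / (real i + 1)))" by (rule exp_of_nat_mult [symmetric])
  also have "\<dots> \<le> exp (1 + 1)" by (simp add: field_simps)
  also have "\<dots> = exp 1 * exp (1 :: real)" by (rule exp_add)
  also have "\<dots> \<le> 3 * 3" by (intro mult_mono exp_le) auto
  also have "\<dots> \<le> real i + 1" using True by simp
  finally show ?thesis .
next
  case False
  then have "i \<in> {0, 1, 2, 3, 4, 5, 6, 7}" by auto
  then show ?thesis by (auto simp: power_divide divide_simps)
qed

text \<open>The left side counts monomials of degree \<open>i\<close> in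
  \<open>(i + 1) * (i + 2) + 1\<close> variables. Passing from \<open>j\<close> to
  \<open>j + 1\<close> applies the recurrence for differences twice, which gains at least the
  required factor \<open>u' + j\<close>.\<close>

lemma pochhammer_le_eulerian_diff_centre:
  "pochhammer ((real i + 1) * (real i + 2) + 1) i / fact i \<le> eulerian_diff (2 * i + 2) i"
proof (induction i)
  case 0
  show ?case by (simp add: eulerian_diff_def)
next
  case (Suc j)
  define L where "L = eulerian_diff (2 * j + 2) j"
  define u u' where "u = (real j + 1) * (real j + 2) + 1" and "u' = (real j + 2) * (real j + 3) + 1"
  define x where "x = (real j + 3) / (real j + 1)"
  have u: "u > 0" "u' > 0" by (auto simp: u_def u'_def intro!: add_pos_pos)
  have x: "x \<ge> 1" by (simp add: x_def)
  have L: "L \<ge> 0" unfolding L_def by (rule eulerian_diff_nonneg) simp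
  \<comment> \<open>\<open>x * u\<close> is \<open>(j + 2) * (j + 3) + x\<close>, and
    \<open>x\<close> is at least 1.\<close>
  have uu': "u' \<le> x * u" unfolding u_def u'_def x_def by (simp add: field_simps)
  have "pochhammer u' j \<le> pochhammer (x * u) j" using u uu' by (intro pochhammer_mono) auto
  also have "\<dots> \<le> x ^ j * pochhammer u j" using x u by (intro pochhammer_mult_le) auto
  also have "\<dots> \<le> (real j + 1) * pochhammer u j"
    using power_ratio_le[of j] u by (intro mult_right_mono) (auto simp: x_def pochhammer_nonneg)
  finally have p: "pochhammer u' j \<le> (real j + 1) * pochhammer u j" .
  have "pochhammer u' (Suc j) / fact (Suc j) = (u' + real j) / (real j + 1) * (pochhammer u' j / fact j)"
    by (simp add: pochhammer_rec' add_ac)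
  also have "\<dots> \<le> (u' + real j) / (real j + 1) * ((real j + 1) * pochhammer u j / fact j)"
    using p u by (intro mult_left_mono divide_right_mono) auto
  also have "\<dots> = (u' + real j) * (pochhammer u j / fact j)" by simp
  also have "\<dots> \<le> (u' + real j) * L"
    using Suc.IH u by (intro mult_left_mono) (auto simp: L_def u_def)
  finally have upper: "pochhammer u' (Suc j) / fact (Suc j) \<le> (u' + real j) * L" .
  have "eulerian (2 * j + 2) (Suc j) = eulerian (2 * j + 2) j" by (rule eulerian_symmetric) simp
  then have L0: "eulerian_diff (2 * j + 2) (Suc j) = 0" by (simp add: eulerian_diff_def)
  have L1: "eulerian_diff (2 * j + 3) (Suc j) = (real j + 3) * L"
    using eulerian_diff_Suc[of j "2 * j + 2"] L0 by (simp add: L_def eval_nat_numeral)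
  have L2: "eulerian_diff (2 * j + 3) j \<ge> (real j + 1) * L"
  proof (cases j)
    case 0
    then show ?thesis by (simp add: L_def eulerian_diff_def)
  next
    case (Suc l)
    have "eulerian_diff (2 * j + 2) l \<ge> 0" using Suc by (intro eulerian_diff_nonneg) simp
    moreover have "eulerian_diff (2 * j + 3) j = (real l + 2) * L
        + (real (2 * j + 2) + 1 - real l) * eulerian_diff (2 * j + 2) l"
      using eulerian_diff_Suc[of l "2 * j + 2"] Suc by (simp add: L_def eval_nat_numeral)
    ultimately show ?thesis using Suc by (simp add: add_ac)
  qed
  have "(u' + real j) * L \<le> ((real j + 2) * (real j + 3) + (real j + 4) * (real j + 1)) * L"
    using L by (intro mult_right_mono) (auto simp: u'_def algebra_simps)
  also have "\<dots> = (real j + 2) * ((real j + 3) * L) + (real j + 4) * ((real j + 1) * L)"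
    by (simp add: algebra_simps)
  also have "\<dots> \<le> (real j + 2) * ((real j + 3) * L) + (real j + 4) * eulerian_diff (2 * j + 3) j"
    using L2 by (intro add_left_mono mult_left_mono) auto
  also have "\<dots> = eulerian_diff (2 * Suc j + 2) (Suc j)"
    using eulerian_diff_Suc[of j "2 * j + 3"] L1 by (simp add: eval_nat_numeral algebra_simps)
  finally have "(u' + real j) * L \<le> eulerian_diff (2 * Suc j + 2) (Suc j)" .
  with upper show ?case by (simp add: u'_def add_ac)
qed

text \<open>Each step in \<open>k\<close> scales the number of variables by the ratio of
  \<open>eulerian_Suc_le_diff\<close>. The left side then grows by a factor of at most
  \<open>i + 1\<close>, the right side by at least \<open>i + 1\<close>.\<close>

lemma pochhammer_le_eulerian_diff:
  "pochhammer (((real i + 1) * (real i + 2) + 1) * ((real i + 3) / (real i + 1)) ^ k) i / fact i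
    \<le> eulerian_diff (2 * i + 2 + k) i"
proof (induction k)
  case 0
  show ?case using pochhammer_le_eulerian_diff_centre[of i] by simp
next
  case (Suc k)
  define x where "x = (real i + 3) / (real i + 1)"
  define U where "U = ((real i + 1) * (real i + 2) + 1) * x ^ k"
  have x: "x \<ge> 1" by (simp add: x_def)
  have U: "U > 0" using x unfolding U_def by (intro mult_pos_pos add_nonneg_pos) auto
  have "pochhammer (x * U) i \<le> x ^ i * pochhammer U i"
    using x U by (intro pochhammer_mult_le) auto
  also have "\<dots> \<le> (real i + 1) * pochhammer U i"
    using power_ratio_le[of i] U by (intro mult_right_mono) (auto simp: x_def pochhammer_nonneg)
  finally have "pochhammer (x * U) i / fact i \<le> (real i + 1) * (pochhammer U i / fact i)"
    by (simp add: divide_right_mono)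
  also have "\<dots> \<le> (real i + 1) * eulerian_diff (2 * i + 2 + k) i"
    using Suc.IH by (intro mult_left_mono) (auto simp: U_def x_def)
  also have "\<dots> \<le> eulerian_diff (2 * i + 2 + Suc k) i"
  proof (cases i)
    case 0
    then show ?thesis by (simp add: eulerian_diff_def)
  next
    case (Suc j)
    have "eulerian_diff (2 * i + 2 + k) j \<ge> 0" using Suc by (intro eulerian_diff_nonneg) simp
    then show ?thesis using eulerian_diff_Suc[of j "2 * i + 2 + k"] Suc by (simp add: add_ac)
  qed
  finally show ?case by (simp add: U_def x_def mult_ac)
qed

text \<open>The number of monomials of degree \<open>i\<close> in \<open>v\<close> variables;
  truncated subtraction gives the right value for \<open>v = 0\<close> too.\<close>

lemma pochhammer_eq_choose:
  "pochhammer (real v) i / fact i = real ((i + v - 1) choose i)"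
proof (cases "v = 0")
  case True
  then show ?thesis by (cases i) (auto simp: pochhammer_0_left)
next
  case False
  have "real ((i + v - 1) choose i) = (real (i + v - 1) gchoose i)"
    by (simp add: binomial_gbinomial)
  also have "real (i + v - 1) = real i + real v - 1" using False by (simp add: of_nat_diff)
  finally show ?thesis by (simp add: gbinomial_pochhammer')
qed

text \<open>The largest \<open>v\<close> with \<open>(i + v - 1) choose i \<le> eulerian_diff m i\<close> works: passing from degree \<open>i\<close>
  in \<open>v + 1\<close> variables to degree \<open>i + 1\<close> in \<open>v\<close> variables multiplies the number of monomials by
  \<open>v / (i + 1)\<close>, which exceeds the ratio of \<open>eulerian m (Suc i)\<close> and \<open>eulerian_diff m i\<close>.\<close>

lemma eulerian_macaulay_growth:
  assumes "2 * Suc i \<le> m"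
  shows "\<exists>v. real ((i + v - 1) choose i) \<le> eulerian_diff m i \<and>
             eulerian m (Suc i) \<le> (Suc i + v - 1) choose Suc i"
proof (cases "i = 0")
  case True
  then show ?thesis by (intro exI[of _ "eulerian m 1"]) (simp add: eulerian_diff_def)
next
  case False
  define k where "k = m - (2 * i + 2)"
  have m: "m = 2 * i + 2 + k" using assms by (simp add: k_def)
  define L x where "L = eulerian_diff m i" and "x = (real i + 3) / (real i + 1)"
  define U where "U = ((real i + 1) * (real i + 2) + 1) * x ^ k"
  have x: "x ^ k \<ge> 1" by (simp add: x_def)
  have U: "U \<ge> 0" using x by (simp add: U_def)
  have L: "L \<ge> 0" unfolding L_def using assms by (intro eulerian_diff_nonneg) simp
  define Q where "Q v \<longleftrightarrow> real ((i + v - 1) choose i) \<le> L" for v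
  \<comment> \<open>With \<open>i > 0\<close> there are at least \<open>v\<close> monomials of
    degree \<open>i\<close>, so \<open>Q\<close> has a greatest element.\<close>
  have bound: "v \<le> nat \<lfloor>L\<rfloor>" if "Q v" for v
  proof -
    have "v \<le> (i + v - 1) choose i"
    proof (cases "v = 0")
      case False
      have "i + v - 1 choose (v - 1) = i + v - 1 choose i"
        using False by (subst binomial_symmetric) auto
      moreover have "v choose (v - 1) \<le> i + v - 1 choose (v - 1)"
        using \<open>i \<noteq> 0\<close> by (intro binomial_right_mono) simp
      moreover have "v choose (v - 1) = v" using False by (cases v) auto
      ultimately show ?thesis by simp
    qed simp
    then have "real v \<le> L" using that unfolding Q_def by linarith
    then show ?thesis by (simp add: le_nat_floor)
  qed
  have "Q 0" using L False by (simp add: Q_def binomial_eq_0)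
  define v where "v = Greatest Q"
  have v: "Q v" "\<not> Q (Suc v)"
    using GreatestI_nat[of Q 0, OF \<open>Q 0\<close> bound] Greatest_le_nat[of Q "Suc v", OF _ bound]
    by (auto simp: v_def)
  have big: "L < pochhammer (real (Suc v)) i / fact i"
    using v(2) unfolding Q_def pochhammer_eq_choose by simp
  have "pochhammer U i / fact i \<le> L"
    using pochhammer_le_eulerian_diff[of i k] by (simp add: U_def x_def L_def m)
  with big have lt: "pochhammer U i / fact i < pochhammer (real (Suc v)) i / fact i" by linarith
  have "U < real (Suc v)"
  proof (rule ccontr)
    assume "\<not> U < real (Suc v)"
    then have "pochhammer (real (Suc v)) i \<le> pochhammer U i" by (intro pochhammer_mono) auto
    then show False using lt by (simp add: divide_right_mono leD)
  qed
  \<comment> \<open>The summand 1 in \<open>U\<close> pays for passing from \<open>v + 1\<close> to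
    \<open>v\<close>, because \<open>x ^ k \<ge> 1\<close>.\<close>
  then have vge: "real v \<ge> (real i + 1) * (real i + 2) * x ^ k"
    using x by (simp add: U_def algebra_simps)
  have "real (eulerian m (Suc i)) \<le> (real i + 2) * x ^ k * L"
    using eulerian_Suc_le_diff[of i k] False by (simp add: m L_def x_def)
  also have "\<dots> \<le> real v / (real i + 1) * L"
    using vge L by (intro mult_right_mono) (auto simp: field_simps)
  also have "\<dots> \<le> real v / (real i + 1) * (pochhammer (real (Suc v)) i / fact i)"
    using big by (intro mult_left_mono) auto
  also have "\<dots> = pochhammer (real v) (Suc i) / fact (Suc i)"
    by (simp add: pochhammer_rec add_ac)
  finally have "eulerian m (Suc i) \<le> (Suc i + v - 1) choose Suc i"
    unfolding pochhammer_eq_choose by simp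
  with v(1) show ?thesis unfolding Q_def L_def by blast
qed


unbundle fps_syntax

section \<open>Power series with centre of symmetry at least \<open>d / 2\<close>\<close>

text \<open>Only sums of generators are formed, so all coefficients are natural numbers. The index
  \<open>d\<close> bounds twice the centre of symmetry from below and adds up in products.\<close>

inductive_set central_cone :: "nat \<Rightarrow> rat fps set" for d where
  zero: "0 \<in> central_cone d"
| add: "f \<in> central_cone d \<Longrightarrow> g \<in> central_cone d \<Longrightarrow> f + g \<in> central_cone d"
| generator: "d \<le> 2 * p + q \<Longrightarrow> fps_X ^ p * (1 + fps_X) ^ q \<in> central_cone d"

lemma central_cone_antimono: "f \<in> central_cone d \<Longrightarrow> e \<le> d \<Longrightarrow> f \<in> central_cone e"
  by (induction rule: central_cone.induct) (auto intro: central_cone.intros)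

lemma central_cone_sum: "(\<And>x. x \<in> A \<Longrightarrow> f x \<in> central_cone d) \<Longrightarrow> sum f A \<in> central_cone d"
  by (induction A rule: infinite_finite_induct) (auto intro: central_cone.intros)

lemma central_cone_mult:
  assumes "f \<in> central_cone d" "g \<in> central_cone e"
  shows "f * g \<in> central_cone (d + e)"
  using assms(1)
proof (induction rule: central_cone.induct)
  case (generator p q)
  from assms(2) show ?case
  proof (induction rule: central_cone.induct)
    case (generator p' q')
    have "(fps_X ^ p * (1 + fps_X) ^ q) * (fps_X ^ p' * (1 + fps_X) ^ q') =
        (fps_X ^ (p + p') * (1 + fps_X) ^ (q + q') :: rat fps)"
      by (simp add: power_add mult_ac)
    then show ?case
      using generator \<open>d \<le> 2 * p + q\<close> by (auto intro!: central_cone.generator)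
  qed (auto simp: distrib_left intro: central_cone.intros)
qed (auto simp: distrib_right intro: central_cone.intros)

lemma central_cone_generator_nth:
  "(fps_X ^ p * (1 + fps_X) ^ q :: rat fps) $ i = (if i < p then 0 else of_nat (q choose (i - p)))"
proof -
  have "((1 + fps_X) ^ q :: rat fps) $ k = of_nat (q choose k)" for k
  proof (induction q arbitrary: k)
    case (Suc q)
    then show ?case
      by (cases k) (simp_all add: distrib_right fps_X_mult_nth)
  qed simp
  then show ?thesis by (simp add: fps_X_power_mult_nth)
qed

lemma central_cone_nth_Nats: "f \<in> central_cone d \<Longrightarrow> f $ i \<in> \<nat>"
  by (induction rule: central_cone.induct) (auto simp: central_cone_generator_nth)

lemma central_cone_nth_nonneg: "f \<in> central_cone d \<Longrightarrow> 0 \<le> f $ i"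
  using central_cone_nth_Nats[of f d i] by (auto elim: Nats_cases)

text \<open>For a generator, a shift by \<open>p\<close> leaves
  \<open>q choose a \<le> q choose b\<close> with \<open>a \<le> b\<close> and
  \<open>a + b \<le> q\<close>; an index \<open>b\<close> beyond the middle is reflected to
  \<open>q - b\<close>.\<close>

lemma central_cone_nth_le:
  assumes "f \<in> central_cone d" "i \<le> j" "i + j \<le> d"
  shows "f $ i \<le> f $ j"
  using assms(1)
proof (induction rule: central_cone.induct)
  case (generator p q)
  show ?case
  proof (cases "i < p")
    case False
    define a b where "a = i - p" and "b = j - p"
    have ab: "a \<le> b" "a + b \<le> q" using generator False assms(2,3) by (auto simp: a_def b_def)
    have "q choose a \<le> q choose b"
    proof (cases "2 * b \<le> q")
      case True
      then show ?thesis using ab by (intro binomial_mono) auto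
    next
      case b: False
      show ?thesis
      proof (cases "b \<le> q")
        case True
        then have "q choose b = q choose (q - b)" by (rule binomial_symmetric)
        then show ?thesis using ab b by (simp add: binomial_mono)
      qed (use ab in simp)
    qed
    then show ?thesis using False assms(2) by (simp add: central_cone_generator_nth a_def b_def)
  qed (simp add: central_cone_generator_nth)
qed (auto intro: add_mono)


section \<open>Strict maps of digraphs\<close>

text \<open>\<open>R\<close> is read only inside \<open>V\<close>, so one relation serves all vertex
  sets of the recursion. A directed cycle in \<open>V\<close> leaves no maps.\<close>

definition strict_maps :: "'a set \<Rightarrow> 'a rel \<Rightarrow> nat \<Rightarrow> ('a \<Rightarrow> nat) set" where
  "strict_maps V R k = {c \<in> V \<rightarrow>\<^sub>E {..<k}. \<forall>x\<in>V. \<forall>y\<in>V. (x, y) \<in> R \<longrightarrow> c x < c y}"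

abbreviation counting_series :: "(nat \<Rightarrow> 'b set) \<Rightarrow> rat fps" where
  "counting_series S \<equiv> Abs_fps (\<lambda>k. of_nat (card (S k)))"

lemma finite_strict_maps: "finite V \<Longrightarrow> finite (strict_maps V R k)"
  unfolding strict_maps_def by (rule finite_subset[of _ "V \<rightarrow>\<^sub>E {..<k}"]) (auto intro: finite_PiE)

lemma strict_maps_insert:
  "u \<in> V \<Longrightarrow> v \<in> V \<Longrightarrow>
    strict_maps V (insert (u, v) R) k = {c \<in> strict_maps V R k. c u < c v}"
  by (auto simp: strict_maps_def)

lemma strict_maps_empty [simp]: "strict_maps {} R k = {\<lambda>_. undefined}"
  by (auto simp: strict_maps_def)

lemma strict_maps_0: "V \<noteq> {} \<Longrightarrow> strict_maps V R 0 = {}"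
  by (auto simp: strict_maps_def PiE_eq_empty_iff)

lemma strict_maps_no_sink:
  assumes "finite V" "V \<noteq> {}" "\<And>x. x \<in> V \<Longrightarrow> \<exists>y\<in>V. (x, y) \<in> R"
  shows "strict_maps V R k = {}"
proof (rule ccontr)
  assume "strict_maps V R k \<noteq> {}"
  then obtain c where c: "c \<in> strict_maps V R k" by auto
  have "Max (c ` V) \<in> c ` V" using assms(1,2) by (intro Max_in) auto
  then obtain x where x: "x \<in> V" "c x = Max (c ` V)" by force
  obtain y where y: "y \<in> V" "(x, y) \<in> R" using assms(3) x by blast
  then have "c x < c y" using c x by (auto simp: strict_maps_def)
  moreover have "c y \<le> Max (c ` V)" using y assms(1) by auto
  ultimately show False using x by simp
qed

text \<open>Given a sink \<open>n\<close>, the set \<open>I\<close> collects the vertices that receive a smaller value than \<open>n\<close>.\<close>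

definition lower_parts :: "'a set \<Rightarrow> 'a rel \<Rightarrow> 'a \<Rightarrow> 'a set set" where
  "lower_parts V R n = {I. I \<subseteq> V - {n} \<and> (\<forall>x\<in>V. (x, n) \<in> R \<longrightarrow> x \<in> I) \<and>
     (\<forall>x\<in>V - {n} - I. \<forall>y\<in>I. (x, y) \<notin> R)}"

text \<open>A map is cut at the value \<open>s\<close> of the sink: the vertices below
  \<open>s\<close> form \<open>I\<close>, and all others are lowered by \<open>s\<close>. The two
  pieces are independent, since no arc leaves \<open>n\<close> and arcs between the parts run only
  from \<open>I\<close> to the rest.\<close>

lemma card_strict_maps_sink:
  assumes fin: "finite V" and n: "n \<in> V" and sink: "\<And>y. y \<in> V \<Longrightarrow> (n, y) \<notin> R"
  shows "card (strict_maps V R k) = (\<Sum>I\<in>lower_parts V R n. \<Sum>s<k.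
    card (strict_maps I R s) * card (strict_maps (V - {n} - I) R (k - s)))"
proof -
  define T where "T = (SIGMA I:lower_parts V R n. SIGMA s:{..<k}.
    strict_maps I R s \<times> strict_maps (V - {n} - I) R (k - s))"
  define low where "low = (\<lambda>c::'a \<Rightarrow> nat. {x \<in> V - {n}. c x < c n})"
  define f where "f = (\<lambda>c. (low c, c n, restrict c (low c),
    restrict (\<lambda>x. c x - c n) (V - {n} - low c)))"
  define g where "g = (\<lambda>(I, s, a, b).
    restrict (\<lambda>x. if x = n then s else if x \<in> I then a x else b x + s :: nat) V)"
  have fin_lower: "finite (lower_parts V R n)"
    by (rule finite_subset[of _ "Pow V"]) (use fin in \<open>auto simp: lower_parts_def\<close>)
  have fin_part: "finite I" if "I \<in> lower_parts V R n" for I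
    using that fin by (auto simp: lower_parts_def dest: finite_subset)
  have gf: "g (f c) = c" if "c \<in> strict_maps V R k" for c
  proof
    fix x show "g (f c) x = c x"
      using that n by (cases "x \<in> V") (auto simp: f_def g_def low_def strict_maps_def)
  qed
  have fg: "f (g t) = t" if "t \<in> T" for t
  proof -
    obtain I s a b where t: "t = (I, s, a, b)" by (cases t) auto
    have I: "I \<in> lower_parts V R n" and s: "s < k" and a: "a \<in> strict_maps I R s"
      and b: "b \<in> strict_maps (V - {n} - I) R (k - s)"
      using that by (auto simp: T_def t)
    have IV: "I \<subseteq> V" "n \<notin> I" using I by (auto simp: lower_parts_def)
    have gn: "g t n = s" using n by (simp add: g_def t)
    have gI: "g t x = a x" if "x \<in> I" for x using that IV by (auto simp: g_def t)
    have gJ: "g t x = b x + s" if "x \<in> V - {n} - I" for x using that by (auto simp: g_def t)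
    have aI: "a x < s" if "x \<in> I" for x using that a by (auto simp: strict_maps_def)
    have low: "low (g t) = I"
    proof (intro set_eqI iffI)
      fix x assume x: "x \<in> low (g t)"
      show "x \<in> I"
      proof (rule ccontr)
        assume "x \<notin> I"
        then have "g t x = b x + s" using x by (intro gJ) (auto simp: low_def)
        then show False using x gn by (simp add: low_def)
      qed
    next
      fix x assume "x \<in> I"
      then show "x \<in> low (g t)" using gI aI gn IV by (auto simp: low_def)
    qed
    have "restrict (g t) I = a"
      using gI a by (auto simp: strict_maps_def fun_eq_iff restrict_def PiE_def extensional_def)
    moreover have "restrict (\<lambda>x. g t x - s) (V - {n} - I) = b"
    proof
      fix x show "restrict (\<lambda>x. g t x - s) (V - {n} - I) x = b x"
        using gJ b by (cases "x \<in> V - {n} - I") (auto simp: strict_maps_def PiE_def extensional_def)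
    qed
    ultimately show ?thesis unfolding f_def low gn by (simp add: t)
  qed
  have fT: "f c \<in> T" if c: "c \<in> strict_maps V R k" for c
  proof -
    have ck: "c x < k" if "x \<in> V" for x using that c by (auto simp: strict_maps_def)
    have cR: "c x < c y" if "x \<in> V" "y \<in> V" "(x, y) \<in> R" for x y
      using that c by (auto simp: strict_maps_def)
    have "low c \<in> lower_parts V R n"
      unfolding lower_parts_def
    proof (intro CollectI conjI ballI impI)
      show "low c \<subseteq> V - {n}" by (auto simp: low_def)
    next
      fix x assume "x \<in> V" "(x, n) \<in> R"
      then show "x \<in> low c" using cR n sink by (auto simp: low_def)
    next
      fix x y assume "x \<in> V - {n} - low c" "y \<in> low c"
      then show "(x, y) \<notin> R" using cR[of x y] by (auto simp: low_def)
    qed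
    moreover have "restrict c (low c) \<in> strict_maps (low c) R (c n)"
      using cR by (auto simp: strict_maps_def low_def)
    moreover have "restrict (\<lambda>x. c x - c n) (V - {n} - low c) \<in> strict_maps (V - {n} - low c) R (k - c n)"
    proof -
      have "c n \<le> c x" if "x \<in> V - {n} - low c" for x using that by (auto simp: low_def)
      then show ?thesis using cR ck by (auto simp: strict_maps_def intro!: diff_less_mono)
    qed
    ultimately show ?thesis using ck n by (auto simp: T_def f_def)
  qed
  have gT: "g t \<in> strict_maps V R k" if "t \<in> T" for t
  proof -
    obtain I s a b where t: "t = (I, s, a, b)" by (cases t) auto
    have I: "I \<in> lower_parts V R n" and s: "s < k" and a: "a \<in> strict_maps I R s"
      and b: "b \<in> strict_maps (V - {n} - I) R (k - s)"
      using that by (auto simp: T_def t)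
    have IV: "I \<subseteq> V" "n \<notin> I" using I by (auto simp: lower_parts_def)
    have gn: "g t n = s" using n by (simp add: g_def t)
    have gI: "g t x = a x" if "x \<in> I" for x using that IV by (auto simp: g_def t)
    have gJ: "g t x = b x + s" if "x \<in> V - {n} - I" for x using that by (auto simp: g_def t)
    have aI: "a x < s" if "x \<in> I" for x using that a by (auto simp: strict_maps_def)
    have bJ: "b x < k - s" if "x \<in> V - {n} - I" for x using that b by (auto simp: strict_maps_def)
    have "g t x < k" if x: "x \<in> V" for x
    proof -
      consider "x = n" | "x \<in> I" | "x \<in> V - {n} - I" using x by auto
      then show ?thesis
      proof cases
        case 1
        then show ?thesis using gn s by simp
      next
        case 2
        then show ?thesis using gI aI[of x] s by simp
      next
        case 3
        then show ?thesis using gJ bJ[of x] by simp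
      qed
    qed
    moreover have "g t x < g t y" if xy: "x \<in> V" "y \<in> V" "(x, y) \<in> R" for x y
    proof -
      have "x \<noteq> n" using xy sink by auto
      consider "x \<in> I" "y \<in> I" | "x \<in> I" "y = n" | "x \<in> I" "y \<in> V - {n} - I"
        | "x \<in> V - {n} - I" "y \<in> V - {n} - I"
        using I xy \<open>x \<noteq> n\<close> unfolding lower_parts_def by blast
      then show ?thesis
      proof cases
        case 1
        then show ?thesis using a xy by (simp add: gI strict_maps_def)
      next
        case 2
        then show ?thesis using aI by (simp add: gI gn)
      next
        case 3
        then show ?thesis using aI[of x] by (simp add: gI gJ)
      next
        case 4
        then have "b x < b y" using b xy by (simp add: strict_maps_def)
        then show ?thesis using 4 by (simp add: gJ)
      qed
    qed
    moreover have "g t \<in> extensional V" by (simp add: g_def t)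
    ultimately show ?thesis by (auto simp: strict_maps_def PiE_def)
  qed
  have "bij_betw f (strict_maps V R k) T"
    by (rule bij_betw_byWitness[of _ g]) (use gf fg fT gT in auto)
  then have "card (strict_maps V R k) = card T" by (rule bij_betw_same_card)
  also have "\<dots> = (\<Sum>I\<in>lower_parts V R n. card (SIGMA s:{..<k}.
    strict_maps I R s \<times> strict_maps (V - {n} - I) R (k - s)))"
    unfolding T_def using fin fin_lower fin_part
    by (intro card_SigmaI) (auto intro!: finite_SigmaI finite_strict_maps)
  also have "\<dots> = (\<Sum>I\<in>lower_parts V R n. \<Sum>s<k. card (strict_maps I R s)
      * card (strict_maps (V - {n} - I) R (k - s)))"
    using fin fin_part
    by (intro sum.cong refl, subst card_SigmaI)
       (auto simp: card_cartesian_product intro!: finite_SigmaI finite_strict_maps)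
  finally show ?thesis .
qed

definition strict_numerator :: "'a set \<Rightarrow> 'a rel \<Rightarrow> rat fps" where
  "strict_numerator V R = (1 - fps_X) ^ (card V + 1) * counting_series (strict_maps V R)"

lemma strict_numerator_empty: "strict_numerator {} R = 1"
proof -
  have "(1 - fps_X) * Abs_fps (\<lambda>_. 1) = (1 :: rat fps)"
    by (rule fps_ext) (simp add: left_diff_distrib fps_X_mult_nth)
  then show ?thesis by (simp add: strict_numerator_def)
qed

text \<open>The convolution over \<open>s < k\<close> becomes a product of series, and the exponents
  add up to \<open>card V + 1\<close>. The part \<open>V - {n}\<close> has an empty complement, so
  it yields partial sums and contributes \<open>fps_X / (1 - fps_X)\<close>.\<close>

lemma strict_numerator_sink:
  assumes fin: "finite V" and n: "n \<in> V" and sink: "\<And>y. y \<in> V \<Longrightarrow> (n, y) \<notin> R"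
  shows "strict_numerator V R = fps_X * strict_numerator (V - {n}) R +
    (\<Sum>I\<in>lower_parts V R n - {V - {n}}. strict_numerator I R * strict_numerator (V - {n} - I) R)"
proof -
  define L where "L = lower_parts V R n"
  define S where "S I = (Abs_fps (\<lambda>k. of_nat (\<Sum>s<k. card (strict_maps I R s)
    * card (strict_maps (V - {n} - I) R (k - s)))) :: rat fps)" for I
  have fin_L: "finite L"
    by (rule finite_subset[of _ "Pow V"]) (use fin in \<open>auto simp: L_def lower_parts_def\<close>)
  have top: "V - {n} \<in> L" using n sink by (auto simp: L_def lower_parts_def)
  have cardV: "card V = Suc (card (V - {n}))" using card.remove[OF fin n] .
  have "counting_series (strict_maps V R) = (\<Sum>I\<in>L. S I)"
    by (rule fps_ext) (simp add: S_def L_def card_strict_maps_sink[OF fin n sink] fps_sum_nth)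
  then have "strict_numerator V R = (\<Sum>I\<in>L. (1 - fps_X) ^ (card V + 1) * S I)"
    by (simp add: strict_numerator_def sum_distrib_left)
  also have "\<dots> = (1 - fps_X) ^ (card V + 1) * S (V - {n}) +
      (\<Sum>I\<in>L - {V - {n}}. (1 - fps_X) ^ (card V + 1) * S I)"
    using fin_L top by (rule sum.remove)
  also have "(1 - fps_X) ^ (card V + 1) * S (V - {n}) = fps_X * strict_numerator (V - {n}) R"
  proof -
    have "(1 - fps_X) * S (V - {n}) = fps_X * counting_series (strict_maps (V - {n}) R)"
    proof (rule fps_ext)
      fix k show "((1 - fps_X) * S (V - {n})) $ k = (fps_X * counting_series (strict_maps (V - {n}) R)) $ k"
        by (cases k) (simp_all add: S_def left_diff_distrib fps_X_mult_nth)
    qed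
    then have "(1 - fps_X) ^ card V * ((1 - fps_X) * S (V - {n})) =
      (1 - fps_X) ^ card V * (fps_X * counting_series (strict_maps (V - {n}) R))" by (rule arg_cong)
    then show ?thesis by (simp add: strict_numerator_def cardV mult_ac)
  qed
  also have "(\<Sum>I\<in>L - {V - {n}}. (1 - fps_X) ^ (card V + 1) * S I) =
      (\<Sum>I\<in>L - {V - {n}}. strict_numerator I R * strict_numerator (V - {n} - I) R)"
  proof (rule sum.cong)
    fix I assume "I \<in> L - {V - {n}}"
    then have I: "I \<subseteq> V - {n}" "V - {n} - I \<noteq> {}" by (auto simp: L_def lower_parts_def)
    have "card (V - {n}) = card I + card (V - {n} - I)"
      using I fin by (metis card_Diff_subset card_mono finite_Diff finite_subset le_add_diff_inverse)
    then have c: "card V + 1 = (card I + 1) + (card (V - {n} - I) + 1)" using cardV by simp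
    have "S I = counting_series (strict_maps I R) * counting_series (strict_maps (V - {n} - I) R)"
    proof (rule fps_ext)
      fix k
      \<comment> \<open>The Cauchy product has the extra term \<open>s = k\<close>, which vanishes
        since the nonempty complement has no map into \<open>{..<0}\<close>.\<close>
      have "(\<Sum>s\<le>k. (of_nat (card (strict_maps I R s)) :: rat) * of_nat (card (strict_maps (V - {n} - I) R (k - s))))
        = (\<Sum>s<k. of_nat (card (strict_maps I R s)) * of_nat (card (strict_maps (V - {n} - I) R (k - s))))"
        using I(2) by (simp add: lessThan_Suc_atMost[symmetric] strict_maps_0)
      then show "S I $ k = (counting_series (strict_maps I R) * counting_series (strict_maps (V - {n} - I) R)) $ k"
        by (simp add: S_def fps_mult_nth atMost_atLeast0)
    qed
    then show "(1 - fps_X) ^ (card V + 1) * S I = strict_numerator I R * strict_numerator (V - {n} - I) R"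
      unfolding c by (simp only: strict_numerator_def power_add mult_ac)
  qed simp
  finally show ?thesis by (simp only: L_def)
qed

text \<open>For nonempty \<open>I\<close> other than \<open>U\<close> the indices add up to
  \<open>card V + 1\<close>. The part \<open>I = {}\<close> contributes only
  \<open>strict_numerator U R\<close>, one short of the index; together with the top term it gives
  \<open>(1 + fps_X) * strict_numerator U R\<close>, which has the right index.\<close>

lemma strict_numerator_in_cone:
  assumes "finite V" "V \<noteq> {}"
  shows "strict_numerator V R \<in> central_cone (card V + 1)"
  using assms
proof (induction "card V" arbitrary: V rule: less_induct)
  case less
  show ?case
  proof (cases "\<exists>n\<in>V. \<forall>y\<in>V. (n, y) \<notin> R")
    case False
    then have "strict_maps V R k = {}" for k
      using less.prems by (intro strict_maps_no_sink) auto
    then have "strict_numerator V R = 0"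
      by (simp add: strict_numerator_def fps_zero_def[symmetric])
    then show ?thesis by (simp add: central_cone.zero)
  next
    case True
    then obtain n where n: "n \<in> V" and sink: "\<And>y. y \<in> V \<Longrightarrow> (n, y) \<notin> R" by auto
    define U L where "U = V - {n}" and "L = lower_parts V R n"
    have finU: "finite U" and cardV: "card V = Suc (card U)"
      using less.prems(1) card.remove[OF less.prems(1) n] by (auto simp: U_def)
    have rec: "strict_numerator V R = fps_X * strict_numerator U R +
      (\<Sum>I\<in>L - {U}. strict_numerator I R * strict_numerator (U - I) R)"
      unfolding U_def L_def using less.prems(1) n sink by (rule strict_numerator_sink)
    have X: "fps_X \<in> central_cone 2"
      using central_cone.generator[of 2 1 0] by simp
    have X1: "1 + fps_X \<in> central_cone 1"
      using central_cone.generator[of 1 0 1] by simp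
    show ?thesis
    proof (cases "U = {}")
      case True
      then have empty: "L - {U} = {}" by (auto simp: L_def U_def lower_parts_def)
      have "strict_numerator V R = fps_X * strict_numerator U R" unfolding rec empty by simp
      then show ?thesis using True X cardV by (simp add: strict_numerator_empty numeral_2_eq_2)
    next
      case False
      have IH: "strict_numerator I R \<in> central_cone (card I + 1)" if "I \<subseteq> U" "I \<noteq> {}" for I
      proof (rule less.hyps)
        show "card I < card V" using card_mono[OF finU that(1)] cardV by simp
      qed (use that finU in \<open>auto dest: finite_subset\<close>)
      have part: "strict_numerator I R * strict_numerator (U - I) R \<in> central_cone (card V + 1)"
        if "I \<in> L - {U} - {{}}" for I
      proof -
        have I: "I \<subseteq> U" "I \<noteq> {}" "U - I \<noteq> {}" using that by (auto simp: L_def U_def lower_parts_def)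
        have "card U = card I + card (U - I)"
          using I finU by (metis card_Diff_subset card_mono finite_subset le_add_diff_inverse)
        then have "card V + 1 = (card I + 1) + (card (U - I) + 1)" using cardV by simp
        then show ?thesis
          using central_cone_mult[OF IH[OF I(1,2)] IH[of "U - I"]] I(3) by simp
      qed
      have finL: "finite L"
        by (rule finite_subset[of _ "Pow V"]) (use less.prems in \<open>auto simp: L_def lower_parts_def\<close>)
      show ?thesis
      proof (cases "{} \<in> L")
        case True
        have "strict_numerator V R = (1 + fps_X) * strict_numerator U R +
          (\<Sum>I\<in>L - {U} - {{}}. strict_numerator I R * strict_numerator (U - I) R)"
          unfolding rec using True False finL
          by (subst sum.remove[of _ "{}"]) (auto simp: strict_numerator_empty distrib_right add_ac)
        moreover have "(1 + fps_X) * strict_numerator U R \<in> central_cone (card V + 1)"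
          using central_cone_mult[OF X1 IH[of U]] False cardV by simp
        ultimately show ?thesis using part
          by (auto intro!: central_cone.add central_cone_sum simp del: Diff_iff Diff_insert2)
      next
        case empty: False
        have "fps_X * strict_numerator U R \<in> central_cone (2 + (card U + 1))"
          using central_cone_mult[OF X IH[of U]] False by simp
        then have "fps_X * strict_numerator U R \<in> central_cone (card V + 1)"
          by (rule central_cone_antimono) (simp add: cardV)
        moreover have "L - {U} = L - {U} - {{}}" using empty by auto
        ultimately show ?thesis unfolding rec using part
          by (auto intro!: central_cone.add central_cone_sum simp del: Diff_iff Diff_insert2)
      qed
    qed
  qed
qed

section \<open>Proper colourings\<close>

definition proper_maps :: "'a set \<Rightarrow> 'a rel \<Rightarrow> nat \<Rightarrow> ('a \<Rightarrow> nat) set" where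
  "proper_maps V E k = {c \<in> V \<rightarrow>\<^sub>E {..<k}. \<forall>(x, y)\<in>E. c x \<noteq> c y}"

lemma finite_proper_maps: "finite V \<Longrightarrow> finite (proper_maps V E k)"
  unfolding proper_maps_def by (rule finite_subset[of _ "V \<rightarrow>\<^sub>E {..<k}"]) (auto intro: finite_PiE)

lemma proper_maps_insert:
  "proper_maps V (insert (u, v) E) k = {c \<in> proper_maps V E k. c u \<noteq> c v}"
  by (auto simp: proper_maps_def)

text \<open>An edge requires \<open>c u < c v\<close> or \<open>c v < c u\<close>, so it moves from
  \<open>E\<close> to \<open>R\<close> in either direction. Contradictory choices, as for an edge
  listed in both orientations, give empty sets.\<close>

lemma mixed_numerator_in_cone:
  assumes "finite V" "V \<noteq> {}" "finite E" "E \<subseteq> V \<times> V"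
  shows "(1 - fps_X) ^ (card V + 1) * counting_series (\<lambda>k. strict_maps V R k \<inter> proper_maps V E k)
    \<in> central_cone (card V + 1)"
  using assms(3,4)
proof (induction E arbitrary: R rule: finite_induct)
  case empty
  have "strict_maps V R k \<inter> proper_maps V {} k = strict_maps V R k" for k
    by (auto simp: strict_maps_def proper_maps_def)
  then show ?case using strict_numerator_in_cone[OF assms(1,2), of R] by (simp add: strict_numerator_def)
next
  case (insert e E)
  obtain u v where e: "e = (u, v)" by (cases e)
  define A B where "A k = strict_maps V (insert (u, v) R) k \<inter> proper_maps V E k"
    and "B k = strict_maps V (insert (v, u) R) k \<inter> proper_maps V E k" for k
  have uv: "u \<in> V" "v \<in> V" using insert.prems e by auto
  have un: "strict_maps V R k \<inter> proper_maps V (insert e E) k = A k \<union> B k" for k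
    using uv by (auto simp: A_def B_def e strict_maps_insert proper_maps_insert)
  have "A k \<inter> B k = {}" for k
    using uv by (auto simp: A_def B_def strict_maps_insert)
  then have "card (strict_maps V R k \<inter> proper_maps V (insert e E) k) = card (A k) + card (B k)" for k
    unfolding un using finite_strict_maps[OF assms(1)] by (intro card_Un_disjoint) (auto simp: A_def B_def)
  then have "counting_series (\<lambda>k. strict_maps V R k \<inter> proper_maps V (insert e E) k) =
      counting_series A + counting_series B"
    by (intro fps_ext) simp
  then show ?case
    using insert.IH[of "insert (u, v) R"] insert.IH[of "insert (v, u) R"] insert.prems
    by (simp add: distrib_left A_def B_def central_cone.add)
qed

lemma proper_numerator_in_cone:
  assumes "finite V" "V \<noteq> {}" "finite E" "E \<subseteq> V \<times> V"
  shows "(1 - fps_X) ^ (card V + 1) * counting_series (proper_maps V E) \<in> central_cone (card V + 1)"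
proof -
  have "strict_maps V {} k \<inter> proper_maps V E k = proper_maps V E k" for k
    by (auto simp: strict_maps_def proper_maps_def)
  then show ?thesis using mixed_numerator_in_cone[OF assms, of "{}"] by simp
qed

text \<open>Colourings with \<open>c u = c v\<close> factor through \<open>r\<close>, which merges
  \<open>v\<close> into \<open>u\<close>. An arc of \<open>E\<close> between \<open>u\<close> and
  \<open>v\<close> becomes a loop, and then both sides are 0.\<close>

lemma card_proper_maps_contract:
  assumes "u \<in> V" "v \<in> V" "u \<noteq> v" "E \<subseteq> V \<times> V"
  defines "r \<equiv> id(v := u)"
  shows "card {c \<in> proper_maps V E k. c u = c v} = card (proper_maps (V - {v}) (map_prod r r ` E) k)"
proof (rule bij_betw_same_card[of "\<lambda>c. restrict c (V - {v})"],
    rule bij_betw_byWitness[of _ "\<lambda>c. restrict (c \<circ> r) V"])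
  let ?f = "\<lambda>c. restrict c (V - {v})" and ?g = "\<lambda>c. restrict (c \<circ> r) V"
  have r: "r x \<in> V - {v}" if "x \<in> V" for x using that assms by (auto simp: r_def)
  have cr: "c (r x) = c x" if "c u = c v" for c :: "'a \<Rightarrow> nat" and x
    using that by (simp add: r_def)
  show "\<forall>c\<in>{c \<in> proper_maps V E k. c u = c v}. ?g (?f c) = c"
    using r cr by (auto simp: proper_maps_def fun_eq_iff PiE_def extensional_def restrict_def)
  show "\<forall>c\<in>proper_maps (V - {v}) (map_prod r r ` E) k. ?f (?g c) = c"
    by (auto simp: proper_maps_def fun_eq_iff PiE_def extensional_def restrict_def r_def)
  show "?f ` {c \<in> proper_maps V E k. c u = c v} \<subseteq> proper_maps (V - {v}) (map_prod r r ` E) k"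
  proof clarify
    fix c assume c: "c \<in> proper_maps V E k" "c u = c v"
    have "?f c (r x) \<noteq> ?f c (r y)" if "(x, y) \<in> E" for x y
      using that r[of x] r[of y] c assms(4) cr[OF c(2)] by (auto simp: proper_maps_def)
    then show "?f c \<in> proper_maps (V - {v}) (map_prod r r ` E) k"
      using c by (auto simp: proper_maps_def simp del: restrict_apply)
  qed
  show "?g ` proper_maps (V - {v}) (map_prod r r ` E) k \<subseteq> {c \<in> proper_maps V E k. c u = c v}"
  proof (rule image_subsetI)
    fix c assume c: "c \<in> proper_maps (V - {v}) (map_prod r r ` E) k"
    have "?g c x \<noteq> ?g c y" if "(x, y) \<in> E" for x y
      using that c assms(4) by (force simp: proper_maps_def)
    moreover have "?g c \<in> V \<rightarrow>\<^sub>E {..<k}"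
      using PiE_mem[of c "V - {v}" "\<lambda>_. {..<k}"] c r by (auto simp: proper_maps_def)
    moreover have "?g c u = ?g c v" using assms(1,2) by (simp add: r_def)
    ultimately show "?g c \<in> {c \<in> proper_maps V E k. c u = c v}"
      by (auto simp: proper_maps_def simp del: restrict_apply)
  qed
qed

text \<open>A new edge adds the colourings that violate it first; contracted, they are proper
  colourings of a graph with one vertex less. Hence the exponent \<open>card V\<close> instead of
  \<open>card V + 1\<close>.\<close>

lemma improper_numerator_in_cone:
  assumes "finite V" "finite E" "E \<subseteq> V \<times> V" "irrefl E"
  shows "(1 - fps_X) ^ card V * Abs_fps (\<lambda>k. of_nat k ^ card V - of_nat (card (proper_maps V E k)))
    \<in> central_cone (card V)"
  using assms(2-4)
proof (induction E rule: finite_induct)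
  case empty
  have "card (proper_maps V {} k) = k ^ card V" for k
    using card_funcsetE[OF assms(1), of "{..<k}"] by (simp add: proper_maps_def)
  then show ?case by (simp add: fps_zero_def[symmetric] central_cone.zero)
next
  case (insert e E)
  obtain u v where e: "e = (u, v)" by (cases e)
  have uv: "u \<in> V" "v \<in> V" "u \<noteq> v" using insert.prems e by (auto simp: irrefl_def)
  define r where "r = id(v := u)"
  define B where "B = proper_maps (V - {v}) (map_prod r r ` E)"
  have cardV: "card V = card (V - {v}) + 1" using card.remove[OF assms(1) uv(2)] by simp
  have "card (proper_maps V (insert e E) k) + card (B k) = card (proper_maps V E k)" for k
  proof -
    have "card (B k) = card {c \<in> proper_maps V E k. c u = c v}"
      unfolding B_def r_def using uv insert.prems by (intro card_proper_maps_contract[symmetric]) auto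
    moreover have "proper_maps V E k = proper_maps V (insert e E) k \<union> {c \<in> proper_maps V E k. c u = c v}"
      by (auto simp: proper_maps_insert e)
    moreover have "proper_maps V (insert e E) k \<inter> {c \<in> proper_maps V E k. c u = c v} = {}"
      by (auto simp: proper_maps_insert e)
    ultimately show ?thesis
      using finite_proper_maps[OF assms(1)] by (metis (no_types, lifting) card_Un_disjoint finite_Un)
  qed
  then have "(of_nat (card (proper_maps V E k)) :: rat) =
      of_nat (card (proper_maps V (insert e E) k)) + of_nat (card (B k))" for k
    by (metis of_nat_add)
  then have eq: "Abs_fps (\<lambda>k. of_nat k ^ card V - of_nat (card (proper_maps V (insert e E) k))) =
      Abs_fps (\<lambda>k. of_nat k ^ card V - of_nat (card (proper_maps V E k))) + counting_series B"
    by (intro fps_ext) simp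
  have "(1 - fps_X) ^ card V * counting_series B \<in> central_cone (card V)"
    unfolding B_def cardV
  proof (rule proper_numerator_in_cone)
    show "map_prod r r ` E \<subseteq> (V - {v}) \<times> (V - {v})"
      using insert.prems uv by (auto simp: r_def split: if_splits)
  qed (use assms(1) insert.hyps uv in auto)
  moreover have "(1 - fps_X) ^ card V * Abs_fps (\<lambda>k. of_nat k ^ card V - of_nat (card (proper_maps V E k)))
    \<in> central_cone (card V)"
    using insert.prems by (intro insert.IH) (auto simp: irrefl_def)
  ultimately show ?case unfolding eq distrib_left by (intro central_cone.add)
qed


section \<open>M-vectors from order ideals of monomials\<close>

definition monomials :: "nat \<Rightarrow> nat \<Rightarrow> (nat \<Rightarrow>\<^sub>0 nat) set" where
  "monomials v i = {t. Poly_Mapping.keys t \<subseteq> {..<v} \<and> mon_degree t = i}"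

lemma mon_degree_eq_sum:
  assumes "finite S" "Poly_Mapping.keys t \<subseteq> S"
  shows "mon_degree t = (\<Sum>x\<in>S. Poly_Mapping.lookup t x)"
  unfolding mon_degree_def using assms
  by (intro sum.mono_neutral_left) (auto simp: in_keys_iff)

lemma mon_degree_add: "mon_degree (s + t) = mon_degree s + mon_degree t"
proof -
  let ?S = "Poly_Mapping.keys s \<union> Poly_Mapping.keys t"
  have "mon_degree (s + t) = (\<Sum>x\<in>?S. Poly_Mapping.lookup (s + t) x)"
    using keys_add[of s t] by (intro mon_degree_eq_sum) auto
  also have "\<dots> = mon_degree s + mon_degree t"
    by (simp add: lookup_add sum.distrib mon_degree_eq_sum[of ?S s] mon_degree_eq_sum[of ?S t])
  finally show ?thesis .
qed

lemma mon_degree_single [simp]: "mon_degree (Poly_Mapping.single x k) = k"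
  by (simp add: mon_degree_def)

lemma keys_add_nat:
  "Poly_Mapping.keys (s + t :: nat \<Rightarrow>\<^sub>0 nat) = Poly_Mapping.keys s \<union> Poly_Mapping.keys t"
  by (auto simp: in_keys_iff lookup_add)

lemma monomials_bij_lists:
  "bij_betw (\<lambda>t. map (Poly_Mapping.lookup t) [0..<v]) (monomials v i)
     {l. length l = v \<and> sum_list l = i}"
proof (rule bij_betw_byWitness[of _ Poly_Mapping.nth])
  have deg: "mon_degree t = sum_list (map (Poly_Mapping.lookup t) [0..<v])"
    if "Poly_Mapping.keys t \<subseteq> {..<v}" for t
    using mon_degree_eq_sum[OF _ that]
    by (simp add: interv_sum_list_conv_sum_set_nat atLeast0LessThan)
  show "(\<lambda>t. map (Poly_Mapping.lookup t) [0..<v]) ` monomials v i \<subseteq> {l. length l = v \<and> sum_list l = i}"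
    using deg by (auto simp: monomials_def)
  show "\<forall>t\<in>monomials v i. Poly_Mapping.nth (map (Poly_Mapping.lookup t) [0..<v]) = t"
    by (auto intro!: poly_mapping_eqI simp: monomials_def nth_default_def in_keys_iff subset_iff)
  show "\<forall>l\<in>{l. length l = v \<and> sum_list l = i}.
      map (Poly_Mapping.lookup (Poly_Mapping.nth l :: nat \<Rightarrow>\<^sub>0 nat)) [0..<v] = l"
    by (auto intro!: nth_equalityI simp: nth_default_def)
  show "Poly_Mapping.nth ` {l. length l = v \<and> sum_list l = i} \<subseteq> monomials v i"
  proof clarify
    fix l :: "nat list" assume v: "v = length l" and i: "i = sum_list l"
    have keys: "Poly_Mapping.keys (Poly_Mapping.nth l) \<subseteq> {..<length l}"
      by (auto simp: in_set_enumerate_eq)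
    have "map (Poly_Mapping.lookup (Poly_Mapping.nth l)) [0..<length l] = l"
      by (auto intro!: nth_equalityI simp: nth_default_def)
    then show "Poly_Mapping.nth l \<in> monomials (length l) (sum_list l)"
      using keys deg[of "Poly_Mapping.nth l"] v by (simp add: monomials_def)
  qed
qed

lemma card_monomials: "card (monomials v i) = (i + v - 1) choose i"
  using bij_betw_same_card[OF monomials_bij_lists] card_length_sum_list by simp

lemma finite_monomials: "finite (monomials v i)"
proof -
  have "{l :: nat list. length l = v \<and> sum_list l = i} \<subseteq> {l. set l \<subseteq> {..i} \<and> length l = v}"
    by (auto intro: member_le_sum_list)
  then have "finite {l :: nat list. length l = v \<and> sum_list l = i}"
    using finite_lists_length_eq[of "{..i}" v] by (auto dest: finite_subset)
  then show ?thesis using bij_betw_finite[OF monomials_bij_lists] by blast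
qed

lemma monomials_mono: "v \<le> w \<Longrightarrow> monomials v i \<subseteq> monomials w i"
  by (auto simp: monomials_def)

text \<open>In a fixed degree these sets form a chain in the number of variables, so cardinalities
  decide inclusion.\<close>

lemma monomials_subset_if_card_le:
  assumes "card (monomials v i) \<le> card (monomials w i)"
  shows "monomials v i \<subseteq> monomials w i"
proof (cases "v \<le> w")
  case False
  then have "monomials w i \<subseteq> monomials v i" by (intro monomials_mono) simp
  then show ?thesis using card_seteq[OF finite_monomials _ assms] by simp
qed (rule monomials_mono)

text \<open>As \<open>M\<close> is closed under divisors, the monomials outside \<open>M\<close>
  span an ideal; the monomials of \<open>M\<close> of degree \<open>i\<close> form a basis of the
  quotient in that degree.\<close>

lemma M_vector_order_ideal:
  fixes M :: "(nat \<Rightarrow>\<^sub>0 nat) set"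
  assumes vars: "\<And>t. t \<in> M \<Longrightarrow> Poly_Mapping.keys t \<subseteq> {..<r}"
    and closed: "\<And>s u. s + u \<in> M \<Longrightarrow> s \<in> M" and zero: "0 \<in> M"
    and deg: "\<And>t. t \<in> M \<Longrightarrow> mon_degree t \<le> d"
    and m: "\<And>i. i \<le> d \<Longrightarrow> m i = of_nat (card {t \<in> M. mon_degree t = i})"
  shows "M_vector TYPE('k::field) d m"
  unfolding M_vector_def
proof (intro exI conjI allI impI)
  define I :: "'k mpoly set" where "I = {p \<in> mpoly_ring r. \<forall>t\<in>Poly_Mapping.keys p. t \<notin> M}"
  show "homogeneous_ideal r I"
    unfolding homogeneous_ideal_def
  proof (intro conjI ballI allI)
    show "I \<subseteq> mpoly_ring r" "0 \<in> I" by (auto simp: I_def mpoly_ring_def)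
  next
    fix f g assume "f \<in> I" "g \<in> I"
    then show "f + g \<in> I" using keys_add[of f g] by (fastforce simp: I_def mpoly_ring_def)
  next
    fix f g :: "'k mpoly" assume f: "f \<in> mpoly_ring r" and g: "g \<in> I"
    have "Poly_Mapping.keys t \<subseteq> {..<r} \<and> t \<notin> M" if t: "t \<in> Poly_Mapping.keys (f * g)" for t
    proof -
      obtain a b where ab: "t = a + b" "a \<in> Poly_Mapping.keys f" "b \<in> Poly_Mapping.keys g"
        using keys_mult[of f g] t by auto
      then have "b \<notin> M" using g by (auto simp: I_def)
      then have "t \<notin> M" using closed[of b a] ab by (auto simp: add.commute)
      then show ?thesis using ab f g by (auto simp: keys_add_nat mpoly_ring_def I_def)
    qed
    then show "f * g \<in> I" by (auto simp: I_def mpoly_ring_def)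
  next
    fix f i assume f: "f \<in> I"
    have "Poly_Mapping.keys (hom_component i f) \<subseteq> Poly_Mapping.keys f"
      unfolding hom_component_def by (rule order_trans[OF keys_sum]) (auto split: if_splits)
    then show "hom_component i f \<in> I" using f by (auto simp: I_def mpoly_ring_def)
  qed
  show "1 \<notin> I" using zero by (auto simp: I_def)
  show "is_hilbert_function r I (\<lambda>i. card {t \<in> M. mon_degree t = i})"
    unfolding is_hilbert_function_def quotient_piece_dim_def
  proof (intro allI)
    fix i
    define N where "N = {t \<in> M. mon_degree t = i}"
    define e where "e = (\<lambda>t. Poly_Mapping.single t (1 :: 'k) :: 'k mpoly)"
    have "N \<subseteq> monomials r i" using vars by (auto simp: N_def monomials_def)
    then have finN: "finite N" using finite_monomials by (rule finite_subset)
    have inj: "inj_on e N"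
    proof (rule inj_onI)
      fix s t assume "e s = e t"
      then have "Poly_Mapping.keys (e s) = Poly_Mapping.keys (e t)" by simp
      then show "s = t" by (simp add: e_def)
    qed
    have comb: "(\<Sum>b\<in>e ` N. Poly_Mapping.single 0 (a b) * b) = (\<Sum>t\<in>N. Poly_Mapping.single t (a (e t)))" for a
      using inj by (simp add: sum.reindex) (simp add: e_def mult_single)
    have lookup_comb: "Poly_Mapping.lookup (\<Sum>t\<in>N. Poly_Mapping.single t (c t)) s = (if s \<in> N then c s else 0)"
      for c :: "(nat \<Rightarrow>\<^sub>0 nat) \<Rightarrow> 'k" and s
      using finN by (simp add: lookup_sum lookup_single when_def)
    show "\<exists>B. finite B \<and> card B = card {t \<in> M. mon_degree t = i} \<and> B \<subseteq> graded_piece r i \<and>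
       (\<forall>a. (\<Sum>b \<in> B. Poly_Mapping.single 0 (a b) * b) \<in> I \<longrightarrow> (\<forall>b \<in> B. a b = 0)) \<and>
       (\<forall>f \<in> graded_piece r i. \<exists>a. f - (\<Sum>b \<in> B. Poly_Mapping.single 0 (a b) * b) \<in> I)"
    proof (intro exI[of _ "e ` N"] conjI allI impI ballI)
      show "finite (e ` N)" using finN by simp
      show "card (e ` N) = card {t \<in> M. mon_degree t = i}"
        using card_image[OF inj] by (simp add: N_def)
      show "e ` N \<subseteq> graded_piece r i"
        using vars by (fastforce simp: e_def N_def graded_piece_def mpoly_ring_def)
    next
      fix a b assume I: "(\<Sum>b\<in>e ` N. Poly_Mapping.single 0 (a b) * b) \<in> I" and b: "b \<in> e ` N"
      obtain t where t: "t \<in> N" "b = e t" using b by blast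
      then have "t \<in> M" by (simp add: N_def)
      have "t \<notin> Poly_Mapping.keys (\<Sum>t\<in>N. Poly_Mapping.single t (a (e t)))"
        using I \<open>t \<in> M\<close> unfolding comb I_def by blast
      then show "a b = 0" using t by (simp add: in_keys_iff lookup_comb)
    next
      fix f :: "'k mpoly" assume f: "f \<in> graded_piece r i"
      define a where "a = (\<lambda>b. Poly_Mapping.lookup f (inv_into N e b))"
      let ?g = "f - (\<Sum>t\<in>N. Poly_Mapping.single t (Poly_Mapping.lookup f t))"
      have "(\<Sum>t\<in>N. Poly_Mapping.single t (a (e t))) = (\<Sum>t\<in>N. Poly_Mapping.single t (Poly_Mapping.lookup f t))"
        using inj by (intro sum.cong) (auto simp: a_def)
      moreover have "t \<in> Poly_Mapping.keys f \<and> t \<notin> M" if "t \<in> Poly_Mapping.keys ?g" for t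
      proof -
        have "t \<in> Poly_Mapping.keys f" "t \<notin> N"
          using that by (auto simp: in_keys_iff lookup_minus lookup_comb split: if_splits)
        then show ?thesis using f by (auto simp: N_def graded_piece_def)
      qed
      then have "?g \<in> I" using f by (auto simp: I_def graded_piece_def mpoly_ring_def)
      ultimately show "\<exists>a. f - (\<Sum>b\<in>e ` N. Poly_Mapping.single 0 (a b) * b) \<in> I"
        unfolding comb by (intro exI[of _ a]) simp
    qed
  qed
  show "m i = of_nat (card {t \<in> M. mon_degree t = i})" if "i \<le> d" for i using m that .
  show "card {t \<in> M. mon_degree t = i} = 0" if "d < i" for i
  proof -
    have "{t \<in> M. mon_degree t = i} = {}" using deg that by fastforce
    then show ?thesis by (simp only: card.empty)
  qed
qed

text \<open>The degree \<open>i\<close> part of the order ideal is squeezed between all monomials in \<open>v i\<close> variables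
  and all monomials in \<open>v (i - 1)\<close> variables, so no monomial order is needed.\<close>

lemma M_vector_growth:
  assumes g0: "g 0 = 1"
    and growth: "\<And>i. i < d \<Longrightarrow>
      \<exists>v. card (monomials v i) \<le> g i \<and> g (Suc i) \<le> card (monomials v (Suc i))"
    and m: "\<And>i. i \<le> d \<Longrightarrow> m i = of_nat (g i)"
  shows "M_vector TYPE('k::field) d m"
proof -
  obtain v where v: "\<And>i. i < d \<Longrightarrow>
      card (monomials (v i) i) \<le> g i \<and> g (Suc i) \<le> card (monomials (v i) (Suc i))"
    using growth by metis
  \<comment> \<open>\<open>lo i\<close> holds every divisor of degree \<open>i\<close> that members
    of degree \<open>i + 1\<close> may have; \<open>hi i\<close> is the room granted by degree
    \<open>i - 1\<close>. In degree \<open>d\<close> nothing is forced.\<close>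
  define lo hi where "lo i = (if i < d then monomials (v i) i else {})"
    and "hi i = (if i = 0 then monomials 0 0 else monomials (v (i - 1)) i)" for i
  have m00: "monomials w 0 = {0}" for w
    by (auto simp: monomials_def mon_degree_def in_keys_iff intro!: poly_mapping_eqI)
  have "\<exists>B. lo i \<subseteq> B \<and> B \<subseteq> hi i \<and> card B = g i" if i: "i \<le> d" for i
  proof -
    have card_lo: "card (lo i) \<le> g i" using v by (auto simp: lo_def)
    have card_hi: "g i \<le> card (hi i)" using v[of "i - 1"] i g0 by (cases i) (auto simp: hi_def m00)
    have "lo i \<subseteq> hi i"
    proof (cases "i = 0 \<or> i = d")
      case True
      then show ?thesis by (auto simp: lo_def hi_def m00)
    next
      case False
      then show ?thesis using order_trans[OF card_lo card_hi] i
        by (simp add: lo_def hi_def monomials_subset_if_card_le)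
    qed
    moreover have "finite (hi i)" by (simp add: hi_def finite_monomials)
    ultimately show ?thesis using exists_subset_between[OF card_lo card_hi] by auto
  qed
  then obtain N where N: "\<And>i. i \<le> d \<Longrightarrow> lo i \<subseteq> N i \<and> N i \<subseteq> hi i \<and> card (N i) = g i"
    by metis
  define M where "M = (\<Union>i\<le>d. N i)"
  have N_deg: "mon_degree t = i" if "t \<in> N i" "i \<le> d" for t i
    using N[OF that(2)] that(1) by (auto simp: hi_def monomials_def split: if_splits)
  have M_part: "{t \<in> M. mon_degree t = i} = N i" if "i \<le> d" for i
    using that N_deg by (auto simp: M_def)
  \<comment> \<open>Removing one variable from a member of degree \<open>i\<close> leaves a monomial
    in \<open>v (i - 1)\<close> variables, hence an element of \<open>lo (i - 1)\<close>.\<close>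
  have step: "s \<in> M" if sx: "s + Poly_Mapping.single x 1 \<in> M" for s x
  proof -
    obtain i where i: "i \<le> d" "s + Poly_Mapping.single x 1 \<in> N i" using sx by (auto simp: M_def)
    then have deg: "i = Suc (mon_degree s)" using N_deg[OF i(2,1)] by (simp add: mon_degree_add)
    then have "s + Poly_Mapping.single x 1 \<in> monomials (v (mon_degree s)) i"
      using N[OF i(1)] i(2) by (auto simp: hi_def)
    then have "s \<in> lo (mon_degree s)"
      using i deg by (auto simp: lo_def monomials_def keys_add_nat)
    then show ?thesis using N[of "mon_degree s"] i deg by (auto simp: M_def)
  qed
  show ?thesis
  proof (rule M_vector_order_ideal)
    fix t assume "t \<in> M"
    then obtain i where i: "i \<le> d" "t \<in> N i" by (auto simp: M_def)
    show "mon_degree t \<le> d" using N_deg[OF i(2,1)] i(1) by simp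
    show "Poly_Mapping.keys t \<subseteq> {..<(\<Sum>i<d. v i)}"
    proof (cases "i = 0")
      case True
      then show ?thesis using N[OF i(1)] i(2) by (auto simp: hi_def m00)
    next
      case False
      then have "v (i - 1) \<le> (\<Sum>i<d. v i)" using i by (intro member_le_sum) auto
      moreover have "t \<in> monomials (v (i - 1)) i" using N[OF i(1)] i(2) False by (auto simp: hi_def)
      ultimately show ?thesis by (auto simp: monomials_def)
    qed
  next
    have "N 0 \<subseteq> {0}" "card (N 0) = 1" using N[of 0] g0 by (auto simp: hi_def m00)
    then have "N 0 = {0}" by (auto simp: subset_singleton_iff)
    then show "0 \<in> M" by (auto simp: M_def)
  next
    fix s u assume "s + u \<in> M"
    then show "s \<in> M"
    proof (induction "mon_degree u" arbitrary: u)
      case 0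
      then have "u \<in> monomials (Suc (Max (Poly_Mapping.keys u))) 0"
        by (auto simp: monomials_def less_Suc_eq_le)
      then have "u = 0" by (simp only: m00 singleton_iff)
      then show ?case using 0 by simp
    next
      case (Suc n)
      then have "Poly_Mapping.keys u \<noteq> {}" by (auto simp: mon_degree_def)
      then obtain x where x: "x \<in> Poly_Mapping.keys u" by blast
      define u' where "u' = u - Poly_Mapping.single x 1"
      have u: "u = u' + Poly_Mapping.single x 1"
        using x by (intro poly_mapping_eqI)
          (auto simp: u'_def lookup_add lookup_minus lookup_single when_def in_keys_iff)
      have "s + u = (s + u') + Poly_Mapping.single x 1" by (subst u) (rule add.assoc[symmetric])
      then have "s + u' \<in> M" using Suc.prems step by metis
      moreover have "mon_degree u = Suc (mon_degree u')" by (subst u) (simp add: mon_degree_add)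
      then have "n = mon_degree u'" using Suc.hyps(2) by simp
      ultimately show ?case using Suc.hyps(1) by blast
    qed
  next
    show "m i = of_nat (card {t \<in> M. mon_degree t = i})" if "i \<le> d" for i
      using m[OF that] M_part[OF that] N[OF that] by simp
  qed
qed


section \<open>The h-vector as an Eulerian polynomial plus a central part\<close>

abbreviation eulerian_series :: "nat \<Rightarrow> rat fps" where
  "eulerian_series m \<equiv> Abs_fps (\<lambda>i. of_nat (eulerian m i))"

text \<open>Raising the exponent multiplies coefficient \<open>j\<close> by \<open>j + 1\<close>,
  the operator sending \<open>F\<close> to \<open>F + fps_X * fps_deriv F\<close>. Differentiating
  the induction hypothesis turns it into the Eulerian recurrence.\<close>

lemma eulerian_series_eq:
  "(1 - fps_X) ^ (m + 1) * Abs_fps (\<lambda>j. of_nat (j + 1) ^ m) = eulerian_series m"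
proof (induction m)
  case 0
  show ?case
  proof (rule fps_ext)
    fix k show "((1 - fps_X) ^ (0 + 1) * Abs_fps (\<lambda>j. of_nat (j + 1) ^ 0)) $ k = eulerian_series 0 $ k"
      by (cases k) (simp_all add: left_diff_distrib fps_X_mult_nth)
  qed
next
  case (Suc m)
  define Y where "Y = (1 - fps_X :: rat fps)"
  define F where "F k = Abs_fps (\<lambda>j. (of_nat (j + 1) :: rat) ^ k)" for k
  define P where "P = eulerian_series m"
  have IH: "Y ^ Suc m * F m = P" using Suc.IH by (simp add: Y_def F_def P_def)
  have F: "F (Suc m) = F m + fps_X * fps_deriv (F m)"
  proof (rule fps_ext)
    fix k show "F (Suc m) $ k = (F m + fps_X * fps_deriv (F m)) $ k"
      by (cases k) (simp_all add: F_def algebra_simps)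
  qed
  have DY: "fps_deriv (Y ^ Suc m) = - of_nat (Suc m) * Y ^ m"
    by (simp add: fps_deriv_power' Y_def del: power_Suc)
  have DP: "fps_deriv P = Y ^ Suc m * fps_deriv (F m) - of_nat (Suc m) * Y ^ m * F m"
    unfolding IH[symmetric] fps_deriv_mult DY by (simp add: algebra_simps del: power_Suc)
  have "Y * fps_deriv P = Y ^ Suc (Suc m) * fps_deriv (F m) - of_nat (Suc m) * (Y ^ Suc m * F m)"
    unfolding DP by (simp add: algebra_simps)
  then have D: "Y ^ Suc (Suc m) * fps_deriv (F m) = Y * fps_deriv P + of_nat (Suc m) * P"
    unfolding IH by simp
  have "Y ^ Suc (Suc m) * F (Suc m) = Y * (Y ^ Suc m * F m) + fps_X * (Y ^ Suc (Suc m) * fps_deriv (F m))"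
    unfolding F by (simp add: algebra_simps)
  also have "\<dots> = Y * P + fps_X * (Y * fps_deriv P + of_nat (Suc m) * P)"
    unfolding IH D ..
  also have "\<dots> = P - fps_X * P + fps_X * fps_deriv P - fps_X * (fps_X * fps_deriv P)
      + of_nat (Suc m) * (fps_X * P)"
    by (simp add: Y_def algebra_simps)
  also have "\<dots> = eulerian_series (Suc m)"
  proof (rule fps_ext)
    fix k
    show "(P - fps_X * P + fps_X * fps_deriv P - fps_X * (fps_X * fps_deriv P)
      + of_nat (Suc m) * (fps_X * P)) $ k = eulerian_series (Suc m) $ k"
    proof (cases k)
      case (Suc l)
      have XX: "(fps_X * (fps_X * fps_deriv P)) $ Suc l = of_nat l * P $ l"
        by (cases l) simp_all
      have lhs: "(P - fps_X * P + fps_X * fps_deriv P - fps_X * (fps_X * fps_deriv P)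
        + of_nat (Suc m) * (fps_X * P)) $ Suc l = (of_nat l + 2) * P $ Suc l + (of_nat m - of_nat l) * P $ l"
        unfolding fps_add_nth fps_sub_nth XX by (simp add: fps_mult_of_nat_nth algebra_simps)
      have "(of_nat l + 2) * P $ Suc l + (of_nat m - of_nat l) * P $ l = eulerian_series (Suc m) $ Suc l"
      proof (cases "l \<le> m")
        case True
        then show ?thesis by (simp add: P_def of_nat_eulerian_Suc_Suc)
      next
        case False
        then show ?thesis by (simp add: P_def eulerian_eq_0)
      qed
      then show ?thesis unfolding Suc lhs .
    qed (simp add: P_def)
  qed
  finally show ?case by (simp add: Y_def F_def)
qed

text \<open>The first form serves the two inequalities and the lower bound on differences, the
  second the upper bound.\<close>

lemma h_series_eq:
  fixes p :: "nat \<Rightarrow> rat"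
  assumes "0 < m"
  defines "f \<equiv> (1 - fps_X) ^ m * Abs_fps (\<lambda>j. of_nat (j + 1) ^ m - p j)"
  shows "f = eulerian_series m + (1 - fps_X) ^ m * Abs_fps (\<lambda>j. of_nat j ^ m - p j)"
    and "(1 - fps_X) * f = eulerian_series m - (1 - fps_X) ^ (m + 1) * Abs_fps p"
proof -
  define F where "F = Abs_fps (\<lambda>j. (of_nat (j + 1) :: rat) ^ m)"
  have f: "f = (1 - fps_X) ^ m * (F - Abs_fps p)"
  proof -
    have "Abs_fps (\<lambda>j. of_nat (j + 1) ^ m - p j) = F - Abs_fps p" by (rule fps_ext) (simp add: F_def)
    then show ?thesis by (simp add: f_def)
  qed
  \<comment> \<open>The constant term uses \<open>0 ^ m = 0\<close>, hence
    \<open>m > 0\<close>.\<close>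
  have XF: "Abs_fps (\<lambda>j. of_nat j ^ m - p j) = fps_X * F - Abs_fps p"
  proof (rule fps_ext)
    fix k show "Abs_fps (\<lambda>j. of_nat j ^ m - p j) $ k = (fps_X * F - Abs_fps p) $ k"
      using assms(1) by (cases k) (simp_all add: F_def)
  qed
  show "f = eulerian_series m + (1 - fps_X) ^ m * Abs_fps (\<lambda>j. of_nat j ^ m - p j)"
    unfolding f XF eulerian_series_eq[symmetric] F_def[symmetric] by (simp add: algebra_simps)
  show "(1 - fps_X) * f = eulerian_series m - (1 - fps_X) ^ (m + 1) * Abs_fps p"
    unfolding f eulerian_series_eq[symmetric] F_def[symmetric] by (simp add: algebra_simps)
qed

section \<open>Cones over graphs\<close>

text \<open>Once \<open>v\<close> has colour \<open>s\<close>, the others avoid \<open>s\<close>;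
  \<open>squash s\<close> renumbers the remaining colours as \<open>{..<k}\<close>, and
  \<open>skip s\<close> undoes it.\<close>

lemma card_proper_maps_cone:
  assumes v: "v \<in> V" and E: "E \<subseteq> V \<times> V" "irrefl E" and adj: "\<And>x. x \<in> V - {v} \<Longrightarrow> (v, x) \<in> E"
  defines "U \<equiv> V - {v}"
  shows "card (proper_maps V E (Suc k)) = Suc k * card (proper_maps U (E \<inter> U \<times> U) k)"
proof -
  define squash where "squash s x = (if x < s then x else x - 1)" for s x :: nat
  define skip where "skip s x = (if x < s then x else Suc x)" for s x :: nat
  define f where "f c = (c v, restrict (\<lambda>x. squash (c v) (c x)) U)" for c :: "'a \<Rightarrow> nat"
  define g where "g = (\<lambda>(s, c). restrict (\<lambda>x. if x = v then s else skip s (c x)) V)"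
  let ?T = "{..<Suc k} \<times> proper_maps U (E \<inter> U \<times> U) k"
  have skip_squash: "skip s (squash s x) = x" if "x \<noteq> s" for s x
    using that by (auto simp: skip_def squash_def)
  have squash_skip: "squash s (skip s x) = x" for s x by (auto simp: skip_def squash_def)
  have skip_inj: "skip s x = skip s y \<longleftrightarrow> x = y" for s x y by (metis squash_skip)
  have skip_neq: "skip s x \<noteq> s" for s x by (auto simp: skip_def)
  have "bij_betw f (proper_maps V E (Suc k)) ?T"
  proof (rule bij_betw_byWitness[of _ g])
    have vneq: "c x \<noteq> c v" if "c \<in> proper_maps V E (Suc k)" "x \<in> U" for c x
      using that adj[of x] by (auto simp: proper_maps_def U_def)
    show "\<forall>c\<in>proper_maps V E (Suc k). g (f c) = c"
    proof (intro ballI ext)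
      fix c x assume c: "c \<in> proper_maps V E (Suc k)"
      show "g (f c) x = c x"
        using c vneq[OF c, of x] skip_squash v
        by (cases "x \<in> V") (auto simp: g_def f_def U_def proper_maps_def)
    qed
    show "\<forall>t\<in>?T. f (g t) = t"
    proof
      fix t assume "t \<in> ?T"
      then obtain s c where t: "t = (s, c)" "c \<in> proper_maps U (E \<inter> U \<times> U) k" by auto
      have "restrict (\<lambda>x. squash s (g (s, c) x)) U = c"
      proof
        fix x show "restrict (\<lambda>x. squash s (g (s, c) x)) U x = c x"
          using t squash_skip by (cases "x \<in> U") (auto simp: g_def U_def proper_maps_def)
      qed
      moreover have "g (s, c) v = s" using v by (simp add: g_def)
      ultimately show "f (g t) = t" by (simp add: f_def t)
    qed
    show "f ` proper_maps V E (Suc k) \<subseteq> ?T"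
    proof (rule image_subsetI)
      fix c assume c: "c \<in> proper_maps V E (Suc k)"
      have ck: "c x \<le> k" if "x \<in> V" for x using c that by (auto simp: proper_maps_def PiE_iff)
      have "squash (c v) (c x) < k" if "x \<in> U" for x
        using vneq[OF c that] ck[of x] ck[OF v] that by (auto simp: squash_def U_def)
      moreover have "squash (c v) (c x) \<noteq> squash (c v) (c y)" if "(x, y) \<in> E" "x \<in> U" "y \<in> U" for x y
      proof -
        have "c x \<noteq> c y" using c that by (auto simp: proper_maps_def)
        then show ?thesis using skip_squash vneq[OF c] that by metis
      qed
      ultimately show "f c \<in> ?T" using ck[OF v] by (auto simp: f_def proper_maps_def)
    qed
    show "g ` ?T \<subseteq> proper_maps V E (Suc k)"
    proof (rule image_subsetI)
      fix t assume "t \<in> ?T"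
      then obtain s c where t: "t = (s, c)" "s \<le> k" "c \<in> proper_maps U (E \<inter> U \<times> U) k" by auto
      have gv: "g t v = s" using v by (simp add: g_def t)
      have gU: "g t x = skip s (c x)" if "x \<in> U" for x using that by (simp add: g_def t U_def)
      have "g t x < Suc k" if x: "x \<in> V" for x
      proof (cases "x = v")
        case False
        then have "c x < k" using t x by (auto simp: proper_maps_def U_def PiE_iff)
        then show ?thesis using gU[of x] False x by (auto simp: skip_def U_def)
      qed (use gv t in simp)
      moreover have "g t x \<noteq> g t y" if xy: "(x, y) \<in> E" for x y
      proof -
        have "x \<noteq> y" "x \<in> V" "y \<in> V" using xy E by (auto simp: irrefl_def)
        then consider "x = v" "y \<in> U" | "y = v" "x \<in> U" | "x \<in> U" "y \<in> U" by (auto simp: U_def)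
        then show ?thesis
        proof cases
          case 3
          then have "c x \<noteq> c y" using t xy by (auto simp: proper_maps_def)
          then show ?thesis using 3 by (simp add: gU skip_inj)
        qed (use gv gU skip_neq in metis)+
      qed
      moreover have "g t \<in> extensional V" by (simp add: g_def t)
      ultimately show "g t \<in> proper_maps V E (Suc k)" by (auto simp: proper_maps_def PiE_iff)
    qed
  qed
  then show ?thesis by (simp add: bij_betw_same_card card_cartesian_product)
qed

section \<open>The number of vertices from the colouring counts\<close>

lemma power_le_card_proper_maps:
  assumes "finite V" "E \<subseteq> V \<times> V" "irrefl E"
  shows "K ^ card V \<le> card (proper_maps V E (card V * K))"
proof -
  obtain e where e: "bij_betw e V {0..<card V}" using ex_bij_betw_finite_nat[OF assms(1)] by blast
  \<comment> \<open>Disjoint blocks of \<open>K\<close> colours, one per vertex, make every choice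
    proper.\<close>
  define B where "B x = {e x * K..<e x * K + K}" for x
  have "(\<Pi>\<^sub>E x\<in>V. B x) \<subseteq> proper_maps V E (card V * K)"
  proof
    fix c assume c: "c \<in> (\<Pi>\<^sub>E x\<in>V. B x)"
    have cB: "e x * K \<le> c x \<and> c x < Suc (e x) * K" if "x \<in> V" for x
      using PiE_mem[OF c that] by (simp add: B_def add.commute)
    have "c x < card V * K" if x: "x \<in> V" for x
    proof -
      have "Suc (e x) \<le> card V" using bij_betwE[OF e] x by (simp add: Suc_le_eq)
      then have "Suc (e x) * K \<le> card V * K" by (rule mult_le_mono1)
      then show ?thesis using cB[OF x] by linarith
    qed
    moreover have "e x = e y" if xy: "x \<in> V" "y \<in> V" "c x = c y" for x y
    proof -
      have "e x * K < Suc (e y) * K" "e y * K < Suc (e x) * K"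
        using cB[OF xy(1)] cB[OF xy(2)] xy(3) by linarith+
      then show ?thesis by (metis mult_less_cancel2 less_Suc_eq_le order_antisym)
    qed
    then have "c x \<noteq> c y" if "(x, y) \<in> E" for x y
      using that assms(2,3) e unfolding bij_betw_def irrefl_def by (metis SigmaD1 SigmaD2 inj_onD subsetD)
    ultimately show "c \<in> proper_maps V E (card V * K)"
      using c by (auto simp: proper_maps_def PiE_iff)
  qed
  then have "card (\<Pi>\<^sub>E x\<in>V. B x) \<le> card (proper_maps V E (card V * K))"
    by (rule card_mono[OF finite_proper_maps[OF assms(1)]])
  then show ?thesis using assms(1) by (simp add: card_PiE B_def)
qed

lemma card_proper_maps_le: "finite V \<Longrightarrow> card (proper_maps V E k) \<le> k ^ card V"
  using card_mono[of "V \<rightarrow>\<^sub>E {..<k}" "proper_maps V E k"]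
  by (auto simp: proper_maps_def card_funcsetE intro: finite_PiE)

lemma card_verts_le:
  assumes "finite V" "E \<subseteq> V \<times> V" "irrefl E" "finite V'"
    and eq: "\<And>k. card (proper_maps V E k) = card (proper_maps V' E' k)"
  shows "card V \<le> card V'"
proof (rule ccontr)
  assume "\<not> card V \<le> card V'"
  then have less: "Suc (card V') \<le> card V" by simp
  \<comment> \<open>One more than the factor \<open>card V ^ card V'\<close> that is left after
    cancelling \<open>K ^ card V'\<close>.\<close>
  define K where "K = Suc (card V ^ card V')"
  have "K ^ Suc (card V') \<le> K ^ card V" using less by (intro power_increasing) (auto simp: K_def)
  also have "\<dots> \<le> card (proper_maps V' E' (card V * K))"
    using power_le_card_proper_maps[OF assms(1-3), of K] eq by simp
  also have "\<dots> \<le> (card V * K) ^ card V'" using assms(4) by (rule card_proper_maps_le)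
  also have "\<dots> = card V ^ card V' * K ^ card V'" by (rule power_mult_distrib)
  finally have "K \<le> card V ^ card V'" by (simp add: K_def)
  then show False by (simp add: K_def)
qed

section \<open>From chromatically equivalent graphs to the M-vector\<close>

lemma proper_colourings_eq: "proper_colourings G k = proper_maps (pverts G) (parcs G) k"
  by (simp add: proper_colourings_def proper_maps_def)

lemma pair_graph_relation:
  assumes "pair_graph G"
  shows "finite (pverts G)" "finite (parcs G)" "parcs G \<subseteq> pverts G \<times> pverts G" "irrefl (parcs G)"
proof -
  interpret pair_graph G by fact
  show "finite (pverts G)" "finite (parcs G)" by (rule pair_finite_verts pair_finite_arcs)+
  show "parcs G \<subseteq> pverts G \<times> pverts G" using arc_fst_in_verts arc_snd_in_verts by fastforce
  show "irrefl (parcs G)" using pair_no_loops by (fastforce simp: irrefl_def)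
qed

definition neighbours :: "'a pair_pre_digraph \<Rightarrow> 'a \<Rightarrow> 'a set" where
  "neighbours H v = {x. (v, x) \<in> parcs H}"

lemma out_degree_eq_card_neighbours: "out_degree (with_proj H) v = card (neighbours H v)"
proof -
  have "out_arcs (with_proj H) v = Pair v ` neighbours H v"
    by (auto simp: out_arcs_def neighbours_def)
  then show ?thesis by (simp add: out_degree_def card_image inj_on_def)
qed

lemma neighbours_subset: "pair_graph H \<Longrightarrow> neighbours H v \<subseteq> pverts H - {v}"
  using pair_graph_relation[of H] by (auto simp: neighbours_def irrefl_def)

text \<open>To be applied to the graph left after removing the vertex of degree
  \<open>n - 1\<close>, so that \<open>card V = n - 1\<close> and \<open>f\<close> is the series of
  the \<open>h'\<close>.\<close>

lemma h_vector_properties: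
  fixes V :: "'a set"
  assumes V: "finite V" "V \<noteq> {}" and E: "finite E" "E \<subseteq> V \<times> V" "irrefl E"
  defines "f \<equiv> (1 - fps_X) ^ card V *
    Abs_fps (\<lambda>j. of_nat (j + 1) ^ card V - of_nat (card (proper_maps V E j)))"
  shows "2 * Suc i < card V \<Longrightarrow> f $ i \<le> f $ Suc i"
    and "i + j + 1 = card V \<Longrightarrow> i \<le> j \<Longrightarrow> f $ i \<le> f $ j"
    and "M_vector TYPE('k::field) (card V div 2) (\<lambda>i. if i = 0 then f $ 0 else f $ i - f $ (i - 1))"
proof -
  define m where "m = card V"
  define C W where "C = (1 - fps_X) ^ m * Abs_fps (\<lambda>j. of_nat j ^ m - of_nat (card (proper_maps V E j)) :: rat)"
    and "W = (1 - fps_X) ^ (m + 1) * counting_series (proper_maps V E)"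
  have m: "m > 0" using V by (simp add: m_def card_gt_0_iff)
  have fC: "f = eulerian_series m + C" and fW: "(1 - fps_X) * f = eulerian_series m - W"
    unfolding f_def C_def W_def m_def[symmetric] using h_series_eq[OF m] by auto
  have C: "C \<in> central_cone m"
    unfolding C_def m_def by (rule improper_numerator_in_cone[OF V(1) E])
  have W: "W \<in> central_cone (m + 1)"
    unfolding W_def m_def by (rule proper_numerator_in_cone[OF V E(1,2)])
  show "f $ i \<le> f $ Suc i" if "2 * Suc i < card V"
    using that eulerian_mono[of i m] central_cone_nth_le[OF C, of i "Suc i"]
    by (simp add: fC m_def add_mono)
  show "f $ i \<le> f $ j" if "i + j + 1 = card V" "i \<le> j"
    using that eulerian_symmetric[of i j m] central_cone_nth_le[OF C, of i j]
    by (simp add: fC m_def)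
  define g where "g i = (if i = 0 then f $ 0 else f $ i - f $ (i - 1))" for i
  have gW: "g i = of_nat (eulerian m i) - W $ i" for i
  proof -
    have "g i = ((1 - fps_X) * f) $ i" by (cases i) (simp_all add: g_def left_diff_distrib)
    then show ?thesis by (simp add: fW)
  qed
  have W_Nats: "W $ i \<in> \<nat>" for i using W by (rule central_cone_nth_Nats)
  \<comment> \<open>\<open>C\<close> increases up to the middle, so the differences of
    \<open>f\<close> are at least those of the Eulerian numbers.\<close>
  have lower: "eulerian_diff m i \<le> of_rat (g i)" if i: "2 * i \<le> m" "i \<noteq> 0" for i
  proof -
    have "C $ (i - 1) \<le> C $ i" using i by (intro central_cone_nth_le[OF C]) auto
    then have "of_nat (eulerian m i) - of_nat (eulerian m (i - 1)) \<le> g i" using i by (simp add: g_def fC)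
    then have "(of_rat (of_nat (eulerian m i) - of_nat (eulerian m (i - 1))) :: real) \<le> of_rat (g i)"
      by (simp only: of_rat_less_eq)
    then show ?thesis using i by (simp add: eulerian_diff_def of_rat_diff)
  qed
  have "proper_maps V E 0 = {}" using V by (auto simp: proper_maps_def PiE_eq_empty_iff)
  then have g0: "g 0 = 1" by (simp add: gW W_def)
  \<comment> \<open>\<open>g i\<close> is a difference of natural numbers by \<open>gW\<close> and
    nonnegative by \<open>lower\<close>.\<close>
  have "\<exists>a. g i = of_nat a" if i: "i \<le> m div 2" for i
  proof (cases "i = 0")
    case True
    then show ?thesis using g0 by (intro exI[of _ 1]) simp
  next
    case False
    obtain w where w: "W $ i = of_nat w" using W_Nats Nats_cases by metis
    have "0 \<le> eulerian_diff m i" using i by (intro eulerian_diff_nonneg) simp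
    then have "0 \<le> g i" using lower[of i] i False by (metis order_trans zero_le_of_rat_iff
      mult.commute div_times_less_eq_dividend mult_le_mono1)
    then have "w \<le> eulerian m i" by (simp add: gW w)
    then show ?thesis by (intro exI[of _ "eulerian m i - w"]) (simp add: gW w of_nat_diff)
  qed
  then obtain a where a: "\<And>i. i \<le> m div 2 \<Longrightarrow> g i = of_nat (a i)" by metis
  have "M_vector TYPE('k) (m div 2) g"
  proof (rule M_vector_growth)
    show "a 0 = 1" using a[of 0] g0 by simp
    show "g i = of_nat (a i)" if "i \<le> m div 2" for i using a that .
    fix i assume i: "i < m div 2"
    then have "2 * Suc i \<le> m" by presburger
    then obtain v where v: "real ((i + v - 1) choose i) \<le> eulerian_diff m i"
        "eulerian m (Suc i) \<le> (Suc i + v - 1) choose Suc i"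
      using eulerian_macaulay_growth[of i m] by auto
    have "(i + v - 1) choose i \<le> a i"
    proof (cases "i = 0")
      case True
      then show ?thesis using a[of 0] g0 by simp
    next
      case False
      note v(1)
      also have "eulerian_diff m i \<le> of_rat (g i)" using i False by (intro lower) auto
      also have "of_rat (g i) = real (a i)" using i by (simp add: a)
      finally show ?thesis by (simp only: of_nat_le_iff)
    qed
    moreover have "a (Suc i) \<le> eulerian m (Suc i)"
    proof -
      have "g (Suc i) \<le> of_nat (eulerian m (Suc i))"
        using central_cone_nth_nonneg[OF W, of "Suc i"] by (simp add: gW)
      then show ?thesis using a[of "Suc i"] i by simp
    qed
    ultimately show "\<exists>v. card (monomials v i) \<le> a i \<and> a (Suc i) \<le> card (monomials v (Suc i))"
      using v(2) unfolding card_monomials by (intro exI[of _ v]) linarith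
  qed
  then show "M_vector TYPE('k) (card V div 2) (\<lambda>i. if i = 0 then f $ 0 else f $ i - f $ (i - 1))"
    unfolding g_def m_def .
qed

theorem theorem5p7:
  fixes G :: "'a pair_pre_digraph" and H :: "'b pair_pre_digraph"
    and n :: nat and h :: "nat \<Rightarrow> rat"
  assumes "pair_graph G" and "card (pverts G) = n" and "n \<ge> 2"
    and "pair_graph H"
    and "chromatic_polynomial G = chromatic_polynomial H"
    and "\<exists>v \<in> pverts H. out_degree (with_proj H) v = n - 1"
    and "(\<Sum>i = 0..n - 2. fps_const (h i) * fps_X ^ i) =
      (1 - fps_X) ^ (n - 1) *
      Abs_fps (\<lambda>j. (of_nat (j + 1) ^ n - of_int (poly (chromatic_polynomial G) (int (j + 1))))
                     / of_nat (j + 1))"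
  shows "(\<forall>i < nat \<lfloor>real (n - 2) / 2\<rfloor>. h i \<le> h (i + 1)) \<and>
    (\<forall>i. real i \<le> real (n - 2) / 2 \<longrightarrow> h i \<le> h (n - 2 - i)) \<and>
    M_vector TYPE('k::field) (nat \<lceil>real (n - 2) / 2\<rceil>)
      (\<lambda>i. if i = 0 then h 0 else h i - h (i - 1))"
proof -
  note G = pair_graph_relation[OF assms(1)] and H = pair_graph_relation[OF assms(4)]
  obtain v where v: "v \<in> pverts H" and deg: "out_degree (with_proj H) v = n - 1"
    using assms(6) by blast
  have "int (card (proper_colourings H k)) = int (card (proper_colourings G k))" for k
    using poly_chromatic_polynomial[OF assms(1)] poly_chromatic_polynomial[OF assms(4)] assms(5) by metis
  then have count: "card (proper_maps (pverts H) (parcs H) k) = card (proper_maps (pverts G) (parcs G) k)" for k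
    by (simp add: proper_colourings_eq)
  \<comment> \<open>Chromatic equivalence bounds the number of vertices of \<open>H\<close> by
    \<open>n\<close>; a vertex of degree \<open>n - 1\<close> in a simple graph gives the converse
    bound.\<close>
  have "card (pverts H) \<le> n"
    using card_verts_le[OF H(1,3,4) G(1) count] assms(2) by simp
  moreover have "n - 1 \<le> card (pverts H) - 1"
    using card_mono[OF _ neighbours_subset[OF assms(4), of v]] deg H(1) v
    by (simp add: out_degree_eq_card_neighbours)
  moreover have "card (pverts H) > 0" using v H(1) by (auto simp: card_gt_0_iff)
  ultimately have cardH: "card (pverts H) = n" using assms(3) by linarith
  define U F where "U = pverts H - {v}" and "F = parcs H \<inter> U \<times> U"
  have U: "finite U" "card U = n - 1" using H(1) v cardH by (simp_all add: U_def)
  then have "U \<noteq> {}" using assms(3) by auto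
  have "neighbours H v = U"
    using U deg neighbours_subset[OF assms(4), of v]
    by (intro card_subset_eq) (auto simp: U_def out_degree_eq_card_neighbours)
  have F: "finite F" "F \<subseteq> U \<times> U" "irrefl F" using H by (auto simp: F_def irrefl_def)
  have cone: "card (proper_maps (pverts H) (parcs H) (Suc k)) = Suc k * card (proper_maps U F k)" for k
    unfolding U_def F_def using v H(3,4) \<open>neighbours H v = U\<close>
    by (intro card_proper_maps_cone) (auto simp: U_def neighbours_def)
  \<comment> \<open>The factor \<open>j + 1\<close> counts the colours of \<open>v\<close> and
    cancels the denominator in the series of \<open>h\<close>.\<close>
  have poly: "(of_int (poly (chromatic_polynomial G) (int (j + 1))) :: rat) =
      of_nat (j + 1) * of_nat (card (proper_maps U F j))" for j
  proof -
    have eq: "poly (chromatic_polynomial G) (int (j + 1)) = int (Suc j * card (proper_maps U F j))"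
      unfolding assms(5) using poly_chromatic_polynomial[OF assms(4), of "Suc j"] cone[of j]
      by (simp add: proper_colourings_eq)
    show ?thesis unfolding eq by (simp add: algebra_simps)
  qed
  define f where "f = (1 - fps_X) ^ card U *
    Abs_fps (\<lambda>j. of_nat (j + 1) ^ card U - (of_nat (card (proper_maps U F j)) :: rat))"
  have "(of_nat (j + 1) ^ n - of_int (poly (chromatic_polynomial G) (int (j + 1)))) / of_nat (j + 1) =
      of_nat (j + 1) ^ card U - (of_nat (card (proper_maps U F j)) :: rat)" for j
  proof -
    have pow: "(of_nat (j + 1) :: rat) ^ n = of_nat (j + 1) * of_nat (j + 1) ^ card U"
      using assms(3) unfolding U(2) power_Suc[symmetric] by simp
    have "(of_nat (j + 1) :: rat) \<noteq> 0" by (simp del: of_nat_Suc of_nat_add)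
    then show ?thesis unfolding poly pow right_diff_distrib[symmetric]
      by (rule nonzero_mult_div_cancel_left)
  qed
  then have sum_f: "(\<Sum>i = 0..n - 2. fps_const (h i) * fps_X ^ i) = f"
    using assms(7) U(2) by (simp only: f_def)
  have h: "h i = f $ i" if "i \<le> n - 2" for i
    unfolding sum_f[symmetric] using that by (simp add: fps_sum_nth if_distrib cong: if_cong)
  note props = h_vector_properties[OF U(1) \<open>U \<noteq> {}\<close> F, folded f_def]
  have floor: "nat \<lfloor>real (n - 2) / 2\<rfloor> = (n - 2) div 2"
    by (metis floor_divide_of_nat_eq nat_int of_nat_numeral)
  have ceil: "nat \<lceil>real (n - 2) / 2\<rceil> = card U div 2"
  proof -
    have "\<lceil>real (n - 2) / 2\<rceil> = int ((n - 1) div 2)"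
      using assms(3) by (intro ceiling_unique) (auto simp: field_simps of_nat_diff; linarith)+
    then show ?thesis by (simp add: U(2))
  qed
  have "M_vector TYPE('k) (card U div 2) (\<lambda>i. if i = 0 then h 0 else h i - h (i - 1))"
  proof -
    have "(if i = 0 then h 0 else h i - h (i - 1)) = (if i = 0 then f $ 0 else f $ i - f $ (i - 1))"
      if "i \<le> card U div 2" for i
    proof -
      \<comment> \<open>\<open>h\<close> is tied to \<open>f\<close> only up to index
        \<open>n - 2\<close>, so the range of the M-vector has to stay within it.\<close>
      have "i \<le> n - 2 \<or> i = 0" using that U(2) assms(3) by linarith
      then show ?thesis using h[of i] h[of "i - 1"] h[of 0] by auto
    qed
    then show ?thesis using props(3) unfolding M_vector_def by auto
  qed
  moreover have "h i \<le> h (i + 1)" if "i < (n - 2) div 2" for i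
    using props(1)[of i] h[of i] h[of "Suc i"] that U(2) by simp
  moreover have "h i \<le> h (n - 2 - i)" if "real i \<le> real (n - 2) / 2" for i
  proof -
    have "2 * i \<le> n - 2" using that by linarith
    then show ?thesis using props(2)[of i "n - 2 - i"] h[of i] h[of "n - 2 - i"] U(2) assms(3) by simp
  qed
  ultimately show ?thesis unfolding floor ceil by blast
qed

end
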